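(* The rewrite system $\rightarrow\;=\;\rightarrow_{elim}\cup\rightarrow_{z}\cup\rightarrow_{hh}$ on the set $\mathbf{PS}$ of Boolean path sums is confluent modulo simple equivalence $\sim$. That is, for all $A,B,C,D\in\mathbf{PS}$ with $A\sim B$, $A\overset{*}{\rightarrow}C$ and $B\overset{*}{\rightarrow}D$, there exist $C',D'\in\mathbf{PS}$ with $C\overset{*}{\rightarrow}C'$, $D\overset{*}{\rightarrow}D'$ and $C'\sim D'$.
   Context: **Path sums.** For a finite set $V$ of indeterminates, $I_V\subseteq\mathbb{F}_2[V]$ is the ideal generated by $v^2-v$, $v\in V$. Elements of $\mathbb{F}_2[V]/I_V$ (Boolean polynomials) are represented by their unique multilinear representatives; degree refers to this representative, and $\mathrm{Var}(f)$ is the set of variables occurring in it; $\mathrm{Var}(f_1,\dots,f_k)=\bigcup_i\mathrm{Var}(f_i)$. A (Boolean) path sum is an expression $A=s_A\sum_{V_A}(-1)^{P_A}|O_A\rangle\langle I_A|$, i.e. a tuple $(V_A,s_A,P_A,O_A,I_A)$ with $V_A$ a finite set of indeterminates, $s_A\in\mathbb{C}$, and $P_A$, the entries of $O_A=(O_{A,1},\dots,O_{A,m})$ and the entries of $I_A=(I_{A,1},\dots,I_{A,n})$ all in $\mathbb{F}_2[V_A]/I_{V_A}$. Its signature is $n\to m$. $\mathbf{PS}$ is the set of all path sums. **Rewrite system.** $\rightarrow$ is the union of the following relations; $[y\leftarrow Q]$ denotes substitution of $y$ by $Q$, applied to all polynomials of the expression. 1. (Elim) If $x\in V$, $x\notin\mathrm{Var}(P,O,I)$: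 $s\sum_V(-1)^P|O\rangle\langle I|\rightarrow_{elim}2s\sum_{V\setminus\{x\}}(-1)^P|O\rangle\langle I|$. 2. (Z) If $z\in V$, $z\notin\mathrm{Var}(R,O,I)$: $s\sum_V(-1)^{z+R}|O\rangle\langle I|\rightarrow_{z}0\sum_{\emptyset}(-1)^0|0,\dots,0\rangle\langle 0,\dots,0|$ (same signature). 3. (HH) If $x,y\in V$ are distinct, $x\notin\mathrm{Var}(Q,R,O,I)$, $y\notin\mathrm{Var}(Q)$ and $|\mathrm{Var}(Q)|\le 1$: $s\sum_V(-1)^{x(y+Q)+R}|O\rangle\langle I|\rightarrow_{hh}\left(s\sum_{V\setminus\{x\}}(-1)^R|O\rangle\langle I|\right)[y\leftarrow Q]$ (the variable $y$ remains in the index set). $\overset{*}{\rightarrow}$ is the reflexive-transitive closure of $\rightarrow$. **Simple equivalence.** A simple transformation is a ring isomorphism $\phi:\mathbb{F}_2[V]\to\mathbb{F}_2[W]$, $|V|=|W|$, such that for each $v\in V$, $\deg\phi(v)=1$ and $|\mathrm{Var}(\phi(v))|\le1$ (so $\phi(v)=w+c$ for some $w\in W$, $c\in\mathbb{F}_2$). It induces an isomorphism $\mathbb{F}_2[V]/I_V\to\mathbb{F}_2[W]/I_W$, also denoted $\phi$, and for a path sum $A$ with $V_A=V$, $\phi(A)=s_A\sum_W(-1)^{\phi(P_A)}|\phi(O_A)\rangle\langle\phi(I_A)|$ (entrywise). $A\sim B$ iff $\phi(A)=B$ for some simple transformation $\phi$. *)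

theory Defs
  imports Complex_Main "HOL-Library.Poly_Mapping" "HOL-Library.Z2" "HOL-Algebra.QuotRing"
begin

section \<open>Polynomials over the two-element field\<close>

type_synonym 'v poly2 = "('v \<Rightarrow>\<^sub>0 nat) \<Rightarrow>\<^sub>0 bit"

definition ind :: "'v \<Rightarrow> 'v poly2" where
  "ind v = Poly_Mapping.single (Poly_Mapping.single v 1) 1"

definition vars :: "'v poly2 \<Rightarrow> 'v set" where
  "vars p = (\<Union>m\<in>Poly_Mapping.keys p. Poly_Mapping.keys m)"

definition mdeg :: "('v \<Rightarrow>\<^sub>0 nat) \<Rightarrow> nat" where
  "mdeg m = (\<Sum>v\<in>Poly_Mapping.keys m. Poly_Mapping.lookup m v)"

definition deg :: "'v poly2 \<Rightarrow> nat" where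
  "deg p = Max (insert 0 (mdeg ` Poly_Mapping.keys p))"

definition F2 :: "'v set \<Rightarrow> 'v poly2 ring" where
  "F2 V = \<lparr>carrier = {p. vars p \<subseteq> V}, mult = (*), one = 1, zero = 0, add = (+)\<rparr>"

definition subst :: "'v \<Rightarrow> 'v poly2 \<Rightarrow> 'v poly2 \<Rightarrow> 'v poly2" where
  "subst y Q p =
     (\<Sum>m\<in>Poly_Mapping.keys p. Poly_Mapping.single 0 (Poly_Mapping.lookup p m) *
        (\<Prod>v\<in>Poly_Mapping.keys m. (if v = y then Q else ind v) ^ Poly_Mapping.lookup m v))"


section \<open>Boolean polynomials\<close>

definition bool_ideal :: "'v set \<Rightarrow> 'v poly2 set" where
  "bool_ideal V = genideal (F2 V) ((\<lambda>v. ind v ^ 2 - ind v) ` V)"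

definition multilinear :: "'v poly2 \<Rightarrow> bool" where
  "multilinear p \<longleftrightarrow> (\<forall>m\<in>Poly_Mapping.keys p. \<forall>v. Poly_Mapping.lookup m v \<le> 1)"

text \<open>
  An element of the quotient of \<open>F2 V\<close> by \<open>bool_ideal V\<close> is represented throughout by its unique
  multilinear representative, i.e. by an element of \<open>BPoly V\<close>. The representative of the coset of
  an arbitrary \<open>p\<close> in \<open>F2 V\<close> is \<open>red V p\<close>; existence and uniqueness are the lemma
  \<open>multilinear_rep_ex1\<close> below.
\<close>

definition BPoly :: "'v set \<Rightarrow> 'v poly2 set" where
  "BPoly V = {p \<in> carrier (F2 V). multilinear p}"

definition red :: "'v set \<Rightarrow> 'v poly2 \<Rightarrow> 'v poly2" where
  "red V p = (THE q. multilinear q \<and> q \<in> bool_ideal V +>\<^bsub>F2 V\<^esub> p)"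


section \<open>Path sums\<close>

text \<open>
  \<open>PathSum V s P Out In\<close> stands for \<open>s \<Sum>\<^sub>V (-1)\<^sup>P |Out\<rangle>\<langle>In|\<close>;
  its signature is \<open>length In \<rightarrow> length Out\<close>.
\<close>

datatype 'v path_sum =
  PathSum "'v set" complex "'v poly2" "'v poly2 list" "'v poly2 list"

inductive_set PS :: "'v path_sum set" where
  "\<lbrakk>finite V; P \<in> BPoly V; set Out \<subseteq> BPoly V; set In \<subseteq> BPoly V\<rbrakk>
     \<Longrightarrow> PathSum V s P Out In \<in> PS"

definition Vars :: "'v poly2 set \<Rightarrow> 'v set" where
  "Vars F = (\<Union>f\<in>F. vars f)"

inductive step_elim :: "'v path_sum \<Rightarrow> 'v path_sum \<Rightarrow> bool" where
  "\<lbrakk>PathSum V s P Out In \<in> PS; x \<in> V; x \<notin> Vars ({P} \<union> set Out \<union> set In)\<rbrakk>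
     \<Longrightarrow> step_elim (PathSum V s P Out In) (PathSum (V - {x}) (2 * s) P Out In)"

inductive step_z :: "'v path_sum \<Rightarrow> 'v path_sum \<Rightarrow> bool" where
  "\<lbrakk>PathSum V s P Out In \<in> PS; z \<in> V; R \<in> BPoly V; P = red V (ind z + R);
    z \<notin> Vars ({R} \<union> set Out \<union> set In)\<rbrakk>
     \<Longrightarrow> step_z (PathSum V s P Out In)
           (PathSum {} 0 0 (replicate (length Out) 0) (replicate (length In) 0))"

inductive step_hh :: "'v path_sum \<Rightarrow> 'v path_sum \<Rightarrow> bool" where
  "\<lbrakk>PathSum V s P Out In \<in> PS; x \<in> V; y \<in> V; x \<noteq> y; Q \<in> BPoly V; R \<in> BPoly V;
    P = red V (ind x * (ind y + Q) + R);
    x \<notin> Vars ({Q, R} \<union> set Out \<union> set In); y \<notin> vars Q; card (vars Q) \<le> 1;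
    W = V - {x}; \<sigma> = (\<lambda>f. red W (subst y Q f))\<rbrakk>
     \<Longrightarrow> step_hh (PathSum V s P Out In) (PathSum W s (\<sigma> R) (map \<sigma> Out) (map \<sigma> In))"

definition step :: "'v path_sum \<Rightarrow> 'v path_sum \<Rightarrow> bool" where
  "step = sup step_elim (sup step_z step_hh)"


section \<open>Simple equivalence\<close>

definition simple_transformation :: "'v set \<Rightarrow> 'v set \<Rightarrow> ('v poly2 \<Rightarrow> 'v poly2) \<Rightarrow> bool" where
  "simple_transformation V W \<phi> \<longleftrightarrow>
     finite V \<and> finite W \<and> card V = card W \<and> \<phi> \<in> ring_iso (F2 V) (F2 W) \<and>
     (\<forall>v\<in>V. deg (\<phi> (ind v)) = 1 \<and> card (vars (\<phi> (ind v))) \<le> 1)"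

text \<open>On multilinear representatives, the isomorphism of quotients induced by \<open>\<phi>\<close> is
  \<open>red W \<circ> \<phi>\<close>.\<close>

fun transform :: "'v set \<Rightarrow> ('v poly2 \<Rightarrow> 'v poly2) \<Rightarrow> 'v path_sum \<Rightarrow> 'v path_sum" where
  "transform W \<phi> (PathSum V s P Out In) =
     PathSum W s (red W (\<phi> P)) (map (red W \<circ> \<phi>) Out) (map (red W \<circ> \<phi>) In)"

fun index_set :: "'v path_sum \<Rightarrow> 'v set" where
  "index_set (PathSum V s P Out In) = V"

definition simple_equiv :: "'v path_sum \<Rightarrow> 'v path_sum \<Rightarrow> bool" (infix \<open>\<sim>\<^sub>s\<close> 50) where
  "A \<sim>\<^sub>s B \<longleftrightarrow> (\<exists>W \<phi>. simple_transformation (index_set A) W \<phi> \<and> transform W \<phi> A = B)"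


section \<open>Existence and uniqueness of multilinear representatives\<close>

text \<open>These rules of \<open>Z2\<close> would rewrite sums and products of coefficients into bit operations.\<close>

declare add_bit_eq_xor [simp del] mult_bit_eq_and [simp del]

lemma poly_mapping_sum_singles:
  fixes p :: "'a \<Rightarrow>\<^sub>0 'b::comm_monoid_add"
  shows "(\<Sum>m\<in>Poly_Mapping.keys p. Poly_Mapping.single m (Poly_Mapping.lookup p m)) = p"
  by (rule poly_mapping_eqI) (auto simp: lookup_sum lookup_single when_def in_keys_iff)

lemma poly_mapping_additive_induct [case_names zero single add]:
  fixes p :: "'a \<Rightarrow>\<^sub>0 'b::comm_monoid_add"
  assumes "P 0" "\<And>m c. c \<noteq> 0 \<Longrightarrow> m \<in> Poly_Mapping.keys p \<Longrightarrow> P (Poly_Mapping.single m c)"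
    "\<And>p q. P p \<Longrightarrow> P q \<Longrightarrow> P (p + q)"
  shows "P p"
proof -
  have "P (\<Sum>m\<in>S. Poly_Mapping.single m (Poly_Mapping.lookup p m))"
    if "S \<subseteq> Poly_Mapping.keys p" for S
    using finite_subset[OF that finite_keys] that
    by (induction S rule: finite_induct) (auto intro!: assms simp: in_keys_iff)
  from this[OF order_refl] show ?thesis by (simp add: poly_mapping_sum_singles)
qed

lemma vars_0 [simp]: "vars 0 = {}" and vars_1 [simp]: "vars 1 = {}"
  and vars_ind [simp]: "vars (ind v) = {v}"
  by (auto simp: vars_def ind_def)

lemma vars_add: "vars (p + q) \<subseteq> vars p \<union> vars q"
  using keys_add[of p q] by (fastforce simp: vars_def)

lemma vars_uminus [simp]: "vars (- p) = vars p"
  by (simp add: vars_def)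

lemma vars_diff: "vars (p - q) \<subseteq> vars p \<union> vars q"
  using vars_add[of p "- q"] by simp

lemma vars_mult: "vars (p * q) \<subseteq> vars p \<union> vars q"
proof
  fix v assume "v \<in> vars (p * q)"
  then obtain m where m: "m \<in> Poly_Mapping.keys (p * q)" "v \<in> Poly_Mapping.keys m"
    by (auto simp: vars_def)
  then obtain a b where "a \<in> Poly_Mapping.keys p" "b \<in> Poly_Mapping.keys q" "m = a + b"
    using keys_mult[of p q] by blast
  then show "v \<in> vars p \<union> vars q"
    using m keys_add[of a b] by (fastforce simp: vars_def)
qed

lemma F2_simps [simp]:
  "carrier (F2 V) = {p. vars p \<subseteq> V}" "mult (F2 V) = (*)" "one (F2 V) = 1"
  "zero (F2 V) = 0" "add (F2 V) = (+)"
  by (simp_all add: F2_def)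

lemma cring_F2: "cring (F2 V)"
proof (rule cringI)
  show "abelian_group (F2 V)"
  proof (rule abelian_groupI)
    fix p assume "p \<in> carrier (F2 V)"
    then show "\<exists>q\<in>carrier (F2 V). q \<oplus>\<^bsub>F2 V\<^esub> p = \<zero>\<^bsub>F2 V\<^esub>"
      by (intro bexI[of _ "- p"]) auto
  qed (simp_all add: add_ac order.trans[OF vars_add])
  show "comm_monoid (F2 V)"
    by (rule comm_monoidI) (simp_all add: mult_ac order.trans[OF vars_mult])
qed (auto simp: algebra_simps)

definition trunc :: "('v \<Rightarrow>\<^sub>0 nat) \<Rightarrow> 'v \<Rightarrow>\<^sub>0 nat" where
  "trunc m = Poly_Mapping.map (min 1) m"

definition ml :: "'v poly2 \<Rightarrow> 'v poly2" where
  "ml p = (\<Sum>m\<in>Poly_Mapping.keys p. Poly_Mapping.single (trunc m) (Poly_Mapping.lookup p m))"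

lemma lookup_trunc: "Poly_Mapping.lookup (trunc m) v = min 1 (Poly_Mapping.lookup m v)"
  by (auto simp: trunc_def map.rep_eq when_def)

lemma keys_trunc [simp]: "Poly_Mapping.keys (trunc m) = Poly_Mapping.keys m"
  by (auto simp: in_keys_iff lookup_trunc)

lemma trunc_add_trunc: "trunc (m + trunc n) = trunc (m + n)"
  by (rule poly_mapping_eqI) (auto simp: lookup_trunc lookup_add)

lemma ml_superset:
  assumes "finite S" "Poly_Mapping.keys p \<subseteq> S"
  shows "ml p = (\<Sum>m\<in>S. Poly_Mapping.single (trunc m) (Poly_Mapping.lookup p m))"
  unfolding ml_def using assms
  by (intro sum.mono_neutral_left) (auto simp: in_keys_iff)

lemma ml_add: "ml (p + q) = ml p + ml q"
proof -
  let ?S = "Poly_Mapping.keys p \<union> Poly_Mapping.keys q"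
  have "Poly_Mapping.keys (p + q) \<subseteq> ?S" using keys_add[of p q] .
  then show ?thesis
    by (simp add: ml_superset[of ?S] lookup_add single_add sum.distrib)
qed

lemma ml_0 [simp]: "ml 0 = 0"
  by (simp add: ml_def)

lemma ml_single [simp]: "ml (Poly_Mapping.single m c) = Poly_Mapping.single (trunc m) c"
  by (auto simp: ml_def)

lemma ml_uminus: "ml (- p) = - ml p"
  by (metis add_eq_0_iff2 ml_0 ml_add neg_eq_iff_add_eq_0)

lemma ml_diff: "ml (p - q) = ml p - ml q"
  using ml_add[of p "- q"] by (simp add: ml_uminus)

lemma ml_mult_ml: "ml (p * ml q) = ml (p * q)"
proof (induction p rule: poly_mapping_additive_induct)
  case (single m c)
  show ?case
    by (induction q rule: poly_mapping_additive_induct)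
       (auto simp: ml_add distrib_left mult_single trunc_add_trunc)
qed (auto simp: distrib_right ml_add)

lemma multilinear_ml: "multilinear (ml p)"
  unfolding multilinear_def
proof (intro ballI allI)
  fix m v assume "m \<in> Poly_Mapping.keys (ml p)"
  then obtain n where "n \<in> Poly_Mapping.keys p" "m = trunc n"
    unfolding ml_def using keys_sum[of _ "Poly_Mapping.keys p"]
    by (fastforce split: if_splits)
  then show "Poly_Mapping.lookup m v \<le> 1" by (simp add: lookup_trunc)
qed

lemma ml_id:
  assumes "multilinear p"
  shows "ml p = p"
proof -
  have "trunc m = m" if "m \<in> Poly_Mapping.keys p" for m
    using assms that by (intro poly_mapping_eqI) (auto simp: multilinear_def lookup_trunc)
  then have "ml p = (\<Sum>m\<in>Poly_Mapping.keys p. Poly_Mapping.single m (Poly_Mapping.lookup p m))"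
    by (simp add: ml_def)
  then show ?thesis using poly_mapping_sum_singles by metis
qed

lemma vars_ml: "vars (ml p) \<subseteq> vars p"
proof
  fix v assume "v \<in> vars (ml p)"
  then obtain m where m: "m \<in> Poly_Mapping.keys (ml p)" "v \<in> Poly_Mapping.keys m"
    by (auto simp: vars_def)
  then obtain n where "n \<in> Poly_Mapping.keys p" "m = trunc n"
    unfolding ml_def using keys_sum[of _ "Poly_Mapping.keys p"]
    by (fastforce split: if_splits)
  then show "v \<in> vars p" using m by (auto simp: vars_def)
qed

lemma multilinear_diff: "multilinear p \<Longrightarrow> multilinear q \<Longrightarrow> multilinear (p - q)"
  by (metis ml_diff ml_id multilinear_ml)

lemma generators_F2: "(\<lambda>v. ind v ^ 2 - ind v) ` V \<subseteq> carrier (F2 V)"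
proof
  fix p assume "p \<in> (\<lambda>v. ind v ^ 2 - ind v) ` V"
  then obtain v where "v \<in> V" "p = ind v * ind v - ind v"
    by (auto simp: power2_eq_square)
  then show "p \<in> carrier (F2 V)"
    using order.trans[OF vars_diff[of "ind v * ind v" "ind v"], of V]
      order.trans[OF vars_mult[of "ind v" "ind v"], of V] by simp
qed

lemma ideal_bool_ideal: "ideal (bool_ideal V) (F2 V)"
  unfolding bool_ideal_def
  by (rule ring.genideal_ideal[OF cring.axioms(1)[OF cring_F2] generators_F2])

lemma ml_bool_ideal:
  assumes "p \<in> bool_ideal V"
  shows "ml p = 0"
proof -
  interpret F: cring "F2 V" by (rule cring_F2)
  let ?K = "{p \<in> carrier (F2 V). ml p = 0}"
  have minus: "\<ominus>\<^bsub>F2 V\<^esub> q = - q" if "vars q \<subseteq> V" for q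
    by (rule F.minus_equality) (use that in auto)
  have "ideal ?K (F2 V)"
  proof (rule idealI)
    show "ring (F2 V)" by (rule F.ring_axioms)
    have "group (add_monoid (F2 V))" by (rule F.add.is_group)
    then show "subgroup ?K (add_monoid (F2 V))"
    proof (rule group.subgroupI)
      fix a assume "a \<in> ?K"
      then show "inv\<^bsub>add_monoid (F2 V)\<^esub> a \<in> ?K"
        using minus[of a] by (simp add: a_inv_def ml_uminus)
    next
      fix a b assume "a \<in> ?K" "b \<in> ?K"
      then show "a \<otimes>\<^bsub>add_monoid (F2 V)\<^esub> b \<in> ?K"
        using vars_add[of a b] by (auto simp: ml_add)
    qed (auto intro!: exI[of _ 0])
  next
    fix a x assume "a \<in> ?K" "x \<in> carrier (F2 V)"
    then show "x \<otimes>\<^bsub>F2 V\<^esub> a \<in> ?K" "a \<otimes>\<^bsub>F2 V\<^esub> x \<in> ?K"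
      using vars_mult[of x a] ml_mult_ml[of x a] by (auto simp: mult.commute)
  qed
  moreover have "(\<lambda>v. ind v ^ 2 - ind v) ` V \<subseteq> ?K"
  proof -
    have "ml (ind v ^ 2 - ind v) = 0" for v :: 'a
    proof -
      have "trunc (Poly_Mapping.single v 1 + Poly_Mapping.single v 1) = trunc (Poly_Mapping.single v 1)"
        by (rule poly_mapping_eqI) (auto simp: lookup_trunc lookup_add lookup_single when_def)
      then show ?thesis
        by (simp add: ml_diff ind_def power2_eq_square mult_single)
    qed
    then show ?thesis using generators_F2[of V] by auto
  qed
  ultimately have "bool_ideal V \<subseteq> ?K"
    unfolding bool_ideal_def by (rule F.genideal_minimal)
  then show ?thesis using assms by auto
qed

lemma bool_ideal_closed:
  shows "0 \<in> bool_ideal V"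
    and "p \<in> bool_ideal V \<Longrightarrow> q \<in> bool_ideal V \<Longrightarrow> p + q \<in> bool_ideal V"
    and "p \<in> bool_ideal V \<Longrightarrow> vars x \<subseteq> V \<Longrightarrow> x * p \<in> bool_ideal V"
    and "v \<in> V \<Longrightarrow> ind v ^ 2 - ind v \<in> bool_ideal V"
    and "p \<in> bool_ideal V \<Longrightarrow> vars p \<subseteq> V"
proof -
  interpret I: ideal "bool_ideal V" "F2 V" by (rule ideal_bool_ideal)
  show "0 \<in> bool_ideal V" using additive_subgroup.zero_closed[OF I.is_additive_subgroup] by simp
  show "p \<in> bool_ideal V \<Longrightarrow> q \<in> bool_ideal V \<Longrightarrow> p + q \<in> bool_ideal V"
    using additive_subgroup.a_closed[OF I.is_additive_subgroup, of p q] by simp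
  show "p \<in> bool_ideal V \<Longrightarrow> vars x \<subseteq> V \<Longrightarrow> x * p \<in> bool_ideal V"
    using I.I_l_closed[of p x] by simp
  show "v \<in> V \<Longrightarrow> ind v ^ 2 - ind v \<in> bool_ideal V"
    unfolding bool_ideal_def using I.genideal_self[OF generators_F2] by blast
  show "p \<in> bool_ideal V \<Longrightarrow> vars p \<subseteq> V" using I.a_Hcarr[of p] by simp
qed

lemma monomial_diff_bool_ideal:
  fixes m :: "'v \<Rightarrow>\<^sub>0 nat"
  assumes "Poly_Mapping.keys m \<subseteq> V"
  shows "Poly_Mapping.single m (1::bit) - Poly_Mapping.single (trunc m) 1 \<in> bool_ideal V"
  using assms
proof (induction m rule: measure_induct_rule[where f = mdeg])
  case (less m)
  show ?case
  proof (cases "\<exists>v. Poly_Mapping.lookup m v \<ge> 2")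
    case False
    then have "trunc m = m"
      by (intro poly_mapping_eqI) (simp add: lookup_trunc not_le less_Suc_eq_le numeral_2_eq_2 min_absorb2)
    then show ?thesis by (simp add: bool_ideal_closed)
  next
    case True
    then obtain v where v: "Poly_Mapping.lookup m v \<ge> 2" by blast
    define e :: "'v \<Rightarrow>\<^sub>0 nat" where "e = Poly_Mapping.single v 1"
    define m' where "m' = m - (e + e)"
    have m: "m = m' + e + e"
      by (rule poly_mapping_eqI)
         (use v in \<open>auto simp: m'_def e_def lookup_add lookup_minus lookup_single when_def\<close>)
    have keys: "Poly_Mapping.keys (m' + e) = Poly_Mapping.keys m"
      by (auto simp: m in_keys_iff lookup_add e_def lookup_single when_def)
    have "mdeg (m' + e) < mdeg m"
      unfolding mdeg_def keys
    proof (rule sum_strict_mono_ex1)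
      show "\<exists>u\<in>Poly_Mapping.keys m. Poly_Mapping.lookup (m' + e) u < Poly_Mapping.lookup m u"
        using v by (intro bexI[of _ v]) (auto simp: m lookup_add e_def in_keys_iff)
    qed (auto simp: m lookup_add)
    moreover have "trunc (m' + e) = trunc m"
      by (rule poly_mapping_eqI)
         (auto simp: m lookup_trunc lookup_add e_def lookup_single when_def)
    ultimately have IH:
      "Poly_Mapping.single (m' + e) (1::bit) - Poly_Mapping.single (trunc m) 1 \<in> bool_ideal V"
      using less.IH[of "m' + e"] less.prems keys by simp
    have vV: "v \<in> V" using less.prems v by (auto simp: in_keys_iff subset_eq)
    have "vars (Poly_Mapping.single m' (1::bit)) \<subseteq> V"
      using less.prems by (auto simp: vars_def m in_keys_iff lookup_add subset_eq)
    then have "Poly_Mapping.single m' 1 * (ind v ^ 2 - ind v) \<in> bool_ideal V"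
      using vV by (intro bool_ideal_closed(3,4))
    also have "Poly_Mapping.single m' 1 * (ind v ^ 2 - ind v) =
        Poly_Mapping.single m (1::bit) - Poly_Mapping.single (m' + e) 1"
      by (simp add: ind_def m e_def power2_eq_square mult_single right_diff_distrib add.assoc)
    finally show ?thesis
      using bool_ideal_closed(2)[OF _ IH] by fastforce
  qed
qed

lemma diff_ml_bool_ideal:
  assumes "vars p \<subseteq> V"
  shows "p - ml p \<in> bool_ideal V"
proof (induction p rule: poly_mapping_additive_induct)
  case zero
  then show ?case by (simp add: bool_ideal_closed)
next
  case (single m c)
  then have "c = 1" "Poly_Mapping.keys m \<subseteq> V" using assms by (auto simp: vars_def)
  then show ?case using monomial_diff_bool_ideal[of m V] by simp
next
  case (add p q)
  then show ?case
    using bool_ideal_closed(2)[of "p - ml p" V "q - ml q"] by (simp add: ml_add algebra_simps)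
qed

lemma coset_iff:
  assumes "vars p \<subseteq> V"
  shows "q \<in> bool_ideal V +>\<^bsub>F2 V\<^esub> p \<longleftrightarrow> q - p \<in> bool_ideal V"
  by (force simp: a_r_coset_def r_coset_def)

lemma red_unique:
  assumes "vars p \<subseteq> V"
  shows "multilinear q \<and> q \<in> bool_ideal V +>\<^bsub>F2 V\<^esub> p \<longleftrightarrow> q = ml p"
proof
  assume q: "multilinear q \<and> q \<in> bool_ideal V +>\<^bsub>F2 V\<^esub> p"
  then have "ml (q - p) = 0" using assms by (intro ml_bool_ideal[of _ V]) (simp add: coset_iff)
  then show "q = ml p" using q by (simp add: ml_diff ml_id)
next
  assume q: "q = ml p"
  interpret I: ideal "bool_ideal V" "F2 V" by (rule ideal_bool_ideal)
  have "(-1) * (p - ml p) \<in> bool_ideal V"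
    by (rule bool_ideal_closed(3)[OF diff_ml_bool_ideal[OF assms]]) simp
  then show "multilinear q \<and> q \<in> bool_ideal V +>\<^bsub>F2 V\<^esub> p"
    using assms by (simp add: q multilinear_ml coset_iff)
qed

lemma multilinear_rep_ex1:
  assumes "p \<in> carrier (F2 V)"
  shows "\<exists>!q. multilinear q \<and> q \<in> bool_ideal V +>\<^bsub>F2 V\<^esub> p"
  using red_unique[of p V] assms by auto

lemma red_eq_ml: "vars p \<subseteq> V \<Longrightarrow> red V p = ml p"
  unfolding red_def using red_unique[of p V] by auto

lemma red_BPoly: "p \<in> carrier (F2 V) \<Longrightarrow> red V p \<in> BPoly V"
  using vars_ml[of p] by (auto simp: BPoly_def red_eq_ml multilinear_ml)

lemma red_id: "p \<in> BPoly V \<Longrightarrow> red V p = p"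
  by (auto simp: BPoly_def red_eq_ml ml_id)


section \<open>Rewriting and simple equivalence stay within the path sums\<close>

lemma vars_sum: "vars (\<Sum>i\<in>I. f i) \<subseteq> (\<Union>i\<in>I. vars (f i))"
proof (induction I rule: infinite_finite_induct)
  case (insert i I)
  then show ?case using vars_add[of "f i" "sum f I"] by auto
qed auto

lemma vars_prod: "vars (\<Prod>i\<in>I. f i) \<subseteq> (\<Union>i\<in>I. vars (f i))"
proof (induction I rule: infinite_finite_induct)
  case (insert i I)
  then show ?case using vars_mult[of "f i" "prod f I"] by auto
qed auto

lemma vars_power: "vars (p ^ n) \<subseteq> vars p"
proof (induction n)
  case (Suc n)
  then show ?case using vars_mult[of p "p ^ n"] by auto
qed auto

lemma vars_subst: "vars (subst y Q p) \<subseteq> (vars p - {y}) \<union> vars Q"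
proof -
  let ?g = "\<lambda>v. if v = y then Q else ind v"
  have "vars (Poly_Mapping.single 0 (Poly_Mapping.lookup p m) *
      (\<Prod>v\<in>Poly_Mapping.keys m. ?g v ^ Poly_Mapping.lookup m v)) \<subseteq> (vars p - {y}) \<union> vars Q"
    (is "vars (?c * ?t) \<subseteq> _")
    if "m \<in> Poly_Mapping.keys p" for m
  proof -
    have "vars ?t \<subseteq> (\<Union>v\<in>Poly_Mapping.keys m. vars (?g v))"
      by (rule order.trans[OF vars_prod]) (intro UN_mono order_refl vars_power)
    also have "\<dots> \<subseteq> (vars p - {y}) \<union> vars Q"
      using that by (fastforce simp: vars_def[of p] split: if_splits)
    finally have "vars ?t \<subseteq> (vars p - {y}) \<union> vars Q" .
    moreover have "vars ?c = {}" by (simp add: vars_def)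
    ultimately show ?thesis using vars_mult[of ?c ?t] by simp
  qed
  then show ?thesis
    unfolding subst_def by (intro order.trans[OF vars_sum]) (rule UN_least)
qed

lemma BPoly_iff: "p \<in> BPoly V \<longleftrightarrow> vars p \<subseteq> V \<and> multilinear p"
  by (simp add: BPoly_def)

lemma step_PS:
  assumes "step A B"
  shows "A \<in> PS" "B \<in> PS"
proof -
  have zero: "0 \<in> BPoly {}" by (simp add: BPoly_iff multilinear_def)
  have hh: "red (V - {x}) (subst y Q f) \<in> BPoly (V - {x})"
    if "f \<in> BPoly V" "x \<notin> vars f" "Q \<in> BPoly V" "x \<notin> vars Q" for V x y Q and f :: "'a poly2"
    using that vars_subst[of y Q f] by (intro red_BPoly) (auto simp: BPoly_iff)
  have "A \<in> PS \<and> B \<in> PS"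
    using assms unfolding step_def sup_apply sup_bool_def
  proof (elim disjE)
    assume "step_elim A B"
    then show ?thesis
    proof cases
      case (1 V s P Out In x)
      then show ?thesis
        by (auto simp: PS.simps BPoly_iff Vars_def subset_iff)
    qed
  next
    assume "step_z A B"
    then show ?thesis
    proof cases
      case (1 V s P Out In z R)
      then show ?thesis using zero by (auto simp: PS.simps)
    qed
  next
    assume "step_hh A B"
    then show ?thesis
    proof cases
      case (1 V s P Out In x y Q R W \<sigma>)
      then have "\<sigma> f \<in> BPoly W" if "f \<in> {R} \<union> set Out \<union> set In" for f
        using that hh[of f V x Q y] by (auto simp: PS.simps Vars_def)
      then show ?thesis using 1 by (auto simp: PS.simps)
    qed
  qed
  then show "A \<in> PS" "B \<in> PS" by auto
qed

lemma simple_equiv_PS: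
  assumes "A \<in> PS" "A \<sim>\<^sub>s B"
  shows "B \<in> PS"
proof -
  obtain V s P Out In where A: "A = PathSum V s P Out In" by (cases A)
  obtain W \<phi> where \<phi>: "simple_transformation V W \<phi>" "B = transform W \<phi> A"
    using assms(2) by (auto simp: simple_equiv_def A)
  then have "\<phi> f \<in> carrier (F2 W)" if "f \<in> BPoly V" for f
    using that ring_iso_memE(1)[of \<phi> "F2 V" "F2 W" f]
    by (auto simp: simple_transformation_def BPoly_def)
  then have "red W (\<phi> f) \<in> BPoly W" if "f \<in> BPoly V" for f
    using that by (intro red_BPoly) auto
  then show ?thesis
    using assms(1) \<phi> by (auto simp: A PS.simps simple_transformation_def)
qed

end

theory Submission
  imports Defs
begin

text \<open>
  Boolean polynomials are determined by their values, so path sums are studied as functions of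
  \<open>V \<rightarrow> F\<^sub>2\<close>. All three rules then concern a variable \<open>x\<close> not occurring in \<open>O\<close>, \<open>I\<close> and the
  derivative \<open>L = P(x + 1) + P(x)\<close>: it is \<open>0\<close> (Elim), \<open>1\<close> (Z), or a nonconstant affine form
  \<open>y + Q\<close> in at most two variables (HH), in which case the sum over \<open>x\<close> restricts to \<open>L = 0\<close>.
  Rewriting decreases \<open>|V|\<close>, and \<open>\<sim>\<close> commutes with single steps, so by well-founded induction it
  is enough to join two steps from a common source up to \<open>\<sim>\<close>. The only delicate overlap is
  HH with HH, where the freedom to change pivots up to \<open>\<sim>\<close> leaves three cases.
\<close>


section \<open>Rewriting of Boolean functions\<close>

text \<open>Strict confluence fails: with V = {x, y, u}, P = x(y + u) and O = (y), the pivots y and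
  u lead, after Elim, to the distinct normal forms |u> over {u} and |y> over {y}. The bound |Var(Q)|
  \<le> 1 confines this ambiguity to \<sim>: for a form y + u + c, the substitutions y <- u + c and
  u <- y + c differ by exchanging y with u and adding c to both. A form in three variables would in
  general leave results related by no renaming with shifts, since the variable replaced becomes a
  sum of two others. The bound also survives substitution, so after one HH step the other keeps its
  side condition. The overlaps are controlled by the symmetry of mixed differences: the derivative
  of P along x changes under a flip of x' exactly as the derivative along x' changes under a flip of
  x. In particular a variable with constant derivative occurs in no form y + Q, so HH disturbs
  neither Elim nor Z.\<close>

definition flip :: "'v \<Rightarrow> ('v \<Rightarrow> bit) \<Rightarrow> 'v \<Rightarrow> bit" where
  "flip x v = v(x := v x + 1)"

text \<open>Semantic counterpart of x not in Var(f); \<open>indep_ev\<close> shows that the two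
  agree for multilinear representatives.\<close>

definition indep :: "'v \<Rightarrow> (('v \<Rightarrow> bit) \<Rightarrow> 'r) \<Rightarrow> bool" where
  "indep x f \<longleftrightarrow> (\<forall>v. f (flip x v) = f v)"

text \<open>Assignments are total on the type \<open>'v\<close>, so membership in the Boolean
  polynomials over V has to be expressed as insensitivity to the values outside V.\<close>

definition supported :: "'v set \<Rightarrow> (('v \<Rightarrow> bit) \<Rightarrow> 'r) \<Rightarrow> bool" where
  "supported V f \<longleftrightarrow> (\<forall>v w. (\<forall>x\<in>V. v x = w x) \<longrightarrow> f v = f w)"

text \<open>Semantic counterpart of |Var(Q)| \<le> 1: the only functions of a single bit u are the
  constants, u and u + 1.\<close>

definition affine1 :: "'v set \<Rightarrow> (('v \<Rightarrow> bit) \<Rightarrow> bit) \<Rightarrow> bool" where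
  "affine1 V Q \<longleftrightarrow> (\<exists>c. Q = (\<lambda>_. c)) \<or> (\<exists>u\<in>V. \<exists>c. Q = (\<lambda>v. v u + c))"

definition assign :: "'v \<Rightarrow> (('v \<Rightarrow> bit) \<Rightarrow> bit) \<Rightarrow> ('v \<Rightarrow> bit) \<Rightarrow> 'v \<Rightarrow> bit" where
  "assign y Q v = v(y := Q v)"

text \<open>The point map dual to the simple transformation sending v to g v + c v. It runs
  backwards, from assignments of the target variables to those of the source, so polynomials are
  transformed by composing with it on the right.\<close>

definition affine_map :: "('v \<Rightarrow> 'v) \<Rightarrow> ('v \<Rightarrow> bit) \<Rightarrow> ('v \<Rightarrow> bit) \<Rightarrow> 'v \<Rightarrow> bit" where
  "affine_map g c w = (\<lambda>v. w (g v) + c v)"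

type_synonym ('v, 'r) state =
  "'v set \<times> complex \<times> (('v \<Rightarrow> bit) \<Rightarrow> bit) \<times> (('v \<Rightarrow> bit) \<Rightarrow> 'r)"

text \<open>
  A path sum is encoded by its index set, its scalar, the phase \<open>P\<close> and a single function \<open>F\<close>
  collecting the values of all entries of \<open>O\<close> and \<open>I\<close>. The parameter \<open>z\<close> of \<open>fstep\<close> is the zero
  value of the given signature. In \<open>pivot\<close>, the condition on \<open>P\<close> expresses
  \<open>P = x(y + Q) + R\<close> with \<open>x \<notin> Var(R)\<close>; since \<open>y + Q\<close> vanishes after \<open>y \<leftarrow> Q\<close>, substituting
  into \<open>R\<close> is the same as substituting into \<open>P\<close>.
\<close>

definition pivot :: "'v set \<Rightarrow> (('v \<Rightarrow> bit) \<Rightarrow> bit) \<Rightarrow> (('v \<Rightarrow> bit) \<Rightarrow> 'r) \<Rightarrow>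
    'v \<Rightarrow> 'v \<Rightarrow> (('v \<Rightarrow> bit) \<Rightarrow> bit) \<Rightarrow> bool" where
  "pivot V P F x y Q \<longleftrightarrow> x \<in> V \<and> y \<in> V \<and> indep x F \<and> affine1 V Q \<and> indep y Q \<and>
     (\<forall>v. P (flip x v) = P v + (v y + Q v))"

inductive fstep :: "'r \<Rightarrow> ('v, 'r) state \<Rightarrow> ('v, 'r) state \<Rightarrow> bool" for z where
  elim: "\<lbrakk>x \<in> V; indep x P; indep x F\<rbrakk> \<Longrightarrow> fstep z (V, s, P, F) (V - {x}, 2 * s, P, F)"
| zero: "\<lbrakk>x \<in> V; \<forall>v. P (flip x v) = P v + 1; indep x F\<rbrakk>
    \<Longrightarrow> fstep z (V, s, P, F) ({}, 0, \<lambda>_. 0, \<lambda>_. z)"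
| hh: "pivot V P F x y Q
    \<Longrightarrow> fstep z (V, s, P, F) (V - {x}, s, P \<circ> assign y Q, F \<circ> assign y Q)"

fun good :: "('v, 'r) state \<Rightarrow> bool" where
  "good (V, s, P, F) \<longleftrightarrow> finite V \<and> supported V P \<and> supported V F"

inductive feq :: "('v, 'r) state \<Rightarrow> ('v, 'r) state \<Rightarrow> bool" where
  "\<lbrakk>bij_betw g V W; P' = P \<circ> affine_map g c; F' = F \<circ> affine_map g c\<rbrakk>
    \<Longrightarrow> feq (V, s, P, F) (W, s, P', F')"

section \<open>Dependence, support and substitution for Boolean functions\<close>

lemma bit_cancel [simp]: "(a::bit) + a = 0" "a + (a + b) = b"
  by (cases a; cases b; simp)+

lemma bit_swap: "(a::bit) = b + c \<longleftrightarrow> a + c = b"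
  by (cases a; cases b; cases c; simp)

lemma flip_flip [simp]: "flip x (flip x v) = v"
  by (simp add: flip_def add.assoc)

lemma flip_commute: "flip x (flip y v) = flip y (flip x v)"
  by (auto simp: flip_def fun_eq_iff)

lemma flip_same [simp]: "flip x v x = v x + 1"
  by (simp add: flip_def)

lemma flip_other [simp]: "u \<noteq> x \<Longrightarrow> flip x v u = v u"
  by (simp add: flip_def)

lemma update_cases: "v(x := b) = v \<or> v(x := b) = flip x v"
proof (cases "b = v x")
  case False
  then have "b = v x + 1" by (cases b; cases "v x"; simp)
  then show ?thesis by (simp add: flip_def)
qed simp

lemma indep_update: "indep x f \<Longrightarrow> f (v(x := b)) = f v"
  using update_cases[of v x b] by (auto simp: indep_def)

lemma indep_const [simp]: "indep x (\<lambda>_. c)"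
  by (simp add: indep_def)

lemma supportedD: "supported V f \<Longrightarrow> (\<And>x. x \<in> V \<Longrightarrow> v x = w x) \<Longrightarrow> f v = f w"
  by (auto simp: supported_def)

lemma supported_const [simp]: "supported V (\<lambda>_. c)"
  by (simp add: supported_def)

lemma supported_indep:
  assumes "supported V f" "x \<notin> V" shows "indep x f"
  unfolding indep_def by (intro allI supportedD[OF assms(1)]) (use assms(2) in \<open>auto simp: flip_def\<close>)

lemma supported_remove:
  assumes "supported V f" "indep x f" shows "supported (V - {x}) f"
  unfolding supported_def
proof (intro allI impI)
  fix v w :: "'a \<Rightarrow> bit" assume "\<forall>u\<in>V - {x}. v u = w u"
  then have "f (v(x := w x)) = f w" by (intro supportedD[OF assms(1)]) auto
  then show "f v = f w" using indep_update[OF assms(2)] by metis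
qed

lemma supported_assign:
  assumes "supported V f" "supported V Q" shows "supported V (f \<circ> assign y Q)"
  unfolding supported_def
proof (intro allI impI)
  fix v w :: "'a \<Rightarrow> bit" assume h: "\<forall>u\<in>V. v u = w u"
  then have "Q v = Q w" using assms(2) by (auto simp: supported_def)
  then show "(f \<circ> assign y Q) v = (f \<circ> assign y Q) w"
    using h by (auto simp: assign_def intro!: supportedD[OF assms(1)])
qed

lemma affine1_supported: "affine1 V Q \<Longrightarrow> supported V Q"
  by (auto simp: affine1_def supported_def)

lemma affine1_remove:
  assumes "affine1 V Q" "indep x Q" shows "affine1 (V - {x}) Q"
proof -
  have False if "Q = (\<lambda>v. v x + c)" for c
    using assms(2) that by (auto simp: indep_def)
  then show ?thesis using assms(1) unfolding affine1_def by blast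
qed

lemma assign_flip:
  assumes "u \<noteq> y" "indep u Q" shows "assign y Q (flip u v) = flip u (assign y Q v)"
  using assms by (auto simp: assign_def flip_def indep_def fun_eq_iff)

lemma indep_assign:
  assumes "indep u f" "u \<noteq> y" "indep u Q" shows "indep u (f \<circ> assign y Q)"
  using assms by (auto simp: indep_def assign_flip)

lemma indep_assign_same:
  assumes "indep y Q" shows "indep y (f \<circ> assign y Q)"
  using assms by (auto simp: indep_def assign_def flip_def)

lemma assign_form:
  "indep y Q \<Longrightarrow> assign y Q v y + Q (assign y Q v) = 0"
  by (simp add: assign_def indep_update)

lemma pivotD:
  assumes "pivot V P F x y Q"
  shows "x \<in> V" "y \<in> V" "indep x F" "affine1 V Q" "indep y Q" "x \<noteq> y" "indep x Q"
    "P (flip x v) = P v + (v y + Q v)" "supported V Q"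
proof -
  show A: "x \<in> V" "y \<in> V" "indep x F" "affine1 V Q" "indep y Q"
    using assms by (auto simp: pivot_def)
  then show "supported V Q" by (simp add: affine1_supported)
  show D: "P (flip x v) = P v + (v y + Q v)" for v using assms by (auto simp: pivot_def)
  \<comment> \<open>Flipping x twice restores P, so the derivative along x cannot itself depend on
    x. This excludes both x = y and an occurrence of x in Q.\<close>
  have L: "flip x v y + Q (flip x v) = v y + Q v" for v
    using D[of v] D[of "flip x v"]
    by (cases "v y + Q v"; cases "flip x v y + Q (flip x v)") auto
  show "x \<noteq> y"
    using L[of "\<lambda>_. 0"] \<open>indep y Q\<close> by (auto simp: indep_def)
  then show "indep x Q" using L by (simp add: indep_def)
qed

text \<open>The derivative y + Q along x vanishes on the image of \<open>assign y Q\<close>, so x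
  disappears from the phase and may leave the index set.\<close>

lemma pivot_indep:
  assumes "pivot V P F x y Q"
  shows "indep x (P \<circ> assign y Q)" "indep x (F \<circ> assign y Q)"
proof -
  note p = pivotD[OF assms]
  show "indep x (P \<circ> assign y Q)"
    using p(5-7) by (simp add: indep_def assign_flip[OF p(6) p(7)] p(8) assign_form)
  show "indep x (F \<circ> assign y Q)" using p by (intro indep_assign)
qed

lemma good_fstep:
  assumes "fstep z A B" "good A" shows "good B"
  using assms
proof cases
  case (hh V P F x y Q s)
  then show ?thesis
    using assms(2) pivotD(9)[OF hh(3)] pivot_indep[OF hh(3)]
    by (simp add: supported_remove supported_assign)
qed (use assms(2) in \<open>simp_all add: supported_remove\<close>)

lemma good_fsteps: "(fstep z)\<^sup>*\<^sup>* A B \<Longrightarrow> good A \<Longrightarrow> good B"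
  by (induction rule: rtranclp_induct) (auto intro: good_fstep)

section \<open>Transport of states and steps along affine renamings\<close>

lemma affine_map_flip:
  assumes "inj_on g V" "x \<in> V" "u \<in> V"
  shows "affine_map g c (flip (g x) w) u = flip x (affine_map g c w) u"
  using assms by (auto simp: affine_map_def flip_def inj_on_def add_ac)

lemma supported_affine_map:
  assumes "supported V f" "g ` V \<subseteq> W" shows "supported W (f \<circ> affine_map g c)"
  unfolding supported_def comp_apply
  by (intro allI impI supportedD[OF assms(1)]) (use assms(2) in \<open>auto simp: affine_map_def\<close>)

lemma supported_affine_map_flip:
  assumes "supported V f" "inj_on g V" "x \<in> V"
  shows "f (affine_map g c (flip (g x) w)) = f (flip x (affine_map g c w))"
  by (rule supportedD[OF assms(1)]) (rule affine_map_flip[OF assms(2,3)])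

lemma good_feq:
  assumes "feq A B" "good A" shows "good B"
  using assms
proof cases
  case (1 g V W P' P c F' F s)
  then show ?thesis
    using assms(2) bij_betw_finite[of g V W] bij_betw_imp_surj_on[of g V W]
      supported_affine_map[of V P g W c] supported_affine_map[of V F g W c] by simp
qed

lemma feq_refl: "feq A A"
proof -
  obtain V s P F where A: "A = (V, s, P, F)" by (cases A)
  show ?thesis unfolding A
    by (rule feq.intros[where g = "\<lambda>v. v" and c = "\<lambda>_. 0"])
       (auto simp: affine_map_def fun_eq_iff bij_betw_def)
qed

lemma feq_sym:
  assumes "feq A B" "good A" shows "feq B A"
  using assms
proof cases
  case (1 g V W P' P c F' F s)
  define h where "h = inv_into V g"
  have h: "bij_betw h W V" "\<And>v. v \<in> V \<Longrightarrow> h (g v) = v"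
    using 1(3) bij_betw_inv_into by (auto simp: h_def bij_betw_def)
  \<comment> \<open>The inverse renaming sends w to h w + c (h w), the two shifts cancelling. The
    composite is the identity only at coordinates in V, which is enough for functions supported on
    V.\<close>
  have *: "affine_map g c (affine_map h (c \<circ> h) v) u = v u" if "u \<in> V" for u v
    using h that by (simp add: affine_map_def add.assoc)
  have "P = P' \<circ> affine_map h (c \<circ> h)" "F = F' \<circ> affine_map h (c \<circ> h)"
    using assms(2) unfolding 1 by (auto simp: fun_eq_iff * intro!: supportedD[of V P] supportedD[of V F])
  then show ?thesis using h(1) unfolding 1(1,2) by (intro feq.intros[where g = h])
qed

lemma feq_trans:
  assumes "feq A B" "feq B C" shows "feq A C"
  using assms(1)
proof cases
  case (1 g V W P' P c F' F s)
  note A = 1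
  from assms(2)[unfolded A(2)] show ?thesis
  proof cases
    case (1 h X P'' d F'')
    have "affine_map g c \<circ> affine_map h d = affine_map (h \<circ> g) (\<lambda>v. d (g v) + c v)"
      by (auto simp: affine_map_def fun_eq_iff add.assoc)
    then show ?thesis
      using bij_betw_trans[OF A(3) 1(2)] unfolding 1 A
      by (auto simp: comp_assoc intro!: feq.intros)
  qed
qed

lemma affine1_affine_map:
  assumes "affine1 V Q" "g ` V \<subseteq> W" shows "affine1 W (\<lambda>w. Q (affine_map g c w) + d)"
  using assms(1) unfolding affine1_def
proof
  assume "\<exists>e. Q = (\<lambda>_. e)"
  then show "(\<exists>e. (\<lambda>w. Q (affine_map g c w) + d) = (\<lambda>_. e)) \<or>
      (\<exists>u\<in>W. \<exists>e. (\<lambda>w. Q (affine_map g c w) + d) = (\<lambda>v. v u + e))" by auto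
next
  assume "\<exists>u\<in>V. \<exists>e. Q = (\<lambda>v. v u + e)"
  then obtain u e where "u \<in> V" "Q = (\<lambda>v. v u + e)" by blast
  then have "g u \<in> W" "(\<lambda>w. Q (affine_map g c w) + d) = (\<lambda>w. w (g u) + (c u + e + d))"
    using assms(2) by (auto simp: affine_map_def add.assoc)
  then show "(\<exists>e. (\<lambda>w. Q (affine_map g c w) + d) = (\<lambda>_. e)) \<or>
      (\<exists>u\<in>W. \<exists>e. (\<lambda>w. Q (affine_map g c w) + d) = (\<lambda>v. v u + e))" by blast
qed

text \<open>The same rule applies to A' with its variables renamed by g, because on V a flip of g x
  is carried to a flip of x. One step is answered by exactly one step.\<close>

lemma fstep_feq:
  assumes "fstep z A B" "feq A A'" "good A"
  shows "\<exists>B'. fstep z A' B' \<and> feq B B'"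
  using assms(2)
proof cases
  case (1 g V W P' P c F' F s)
  note A = 1
  let ?T = "affine_map g c"
  have inj: "inj_on g V" and W: "W = g ` V" using A(3) by (auto simp: bij_betw_def)
  have good: "supported V P" "supported V F" using assms(3) by (auto simp: A)
  note flip = supported_affine_map_flip[OF _ inj]
  have indF: "indep (g x) F'" if "indep x F" "x \<in> V" for x
    using that good by (auto simp: A indep_def flip)
  have bij: "bij_betw g (V - {x}) (W - {g x})" if "x \<in> V" for x
    using that inj W by (auto simp: bij_betw_def inj_on_def)
  from assms(1)[unfolded A(1)] show ?thesis
  proof cases
    case (elim x)
    have "fstep z (W, s, P', F') (W - {g x}, 2 * s, P', F')"
      using elim good indF by (intro fstep.elim) (auto simp: W A indep_def flip)
    moreover have "feq (V - {x}, 2 * s, P, F) (W - {g x}, 2 * s, P', F')"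
      using A by (intro feq.intros[OF bij]) (use elim in auto)
    ultimately show ?thesis using elim A by blast
  next
    case (zero x)
    have "fstep z (W, s, P', F') ({}, 0, \<lambda>_. 0, \<lambda>_. z)"
      using zero good indF by (intro fstep.zero[of "g x"]) (auto simp: W A indep_def flip)
    then show ?thesis using zero A feq_refl by blast
  next
    case (hh x y Q)
    note p = pivotD[OF hh(2)]
    \<comment> \<open>The form y + Q pulls back to g y + c y + Q o \<open>?T\<close>; the shift at y
      is absorbed into the new Q.\<close>
    define Q' where "Q' = (\<lambda>w. Q (?T w) + c y)"
    have "affine1 W Q'" unfolding Q'_def
      by (rule affine1_affine_map[OF p(4)]) (simp add: W)
    moreover have "indep (g y) Q'"
      using p(5) by (auto simp: Q'_def indep_def flip[OF p(9) p(2)])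
    moreover have "P' (flip (g x) w) = P' w + (w (g y) + Q' w)" for w
      using p(8)[of "?T w"] by (simp add: A flip[OF good(1) p(1)] Q'_def)
        (simp add: affine_map_def add_ac)
    ultimately have "pivot W P' F' (g x) (g y) Q'"
      unfolding pivot_def using p indF W by auto
    then have "fstep z (W, s, P', F') (W - {g x}, s, P' \<circ> assign (g y) Q', F' \<circ> assign (g y) Q')"
      by (rule fstep.hh)
    moreover have "feq (V - {x}, s, P \<circ> assign y Q, F \<circ> assign y Q)
        (W - {g x}, s, P' \<circ> assign (g y) Q', F' \<circ> assign (g y) Q')"
    proof (rule feq.intros[OF bij[OF p(1)]])
      have *: "?T (assign (g y) Q' w) u = assign y Q (?T w) u" if "u \<in> V" for u w
        using that p(2) inj
        by (auto simp: affine_map_def assign_def Q'_def inj_on_def add.assoc)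
      show "P' \<circ> assign (g y) Q' = P \<circ> assign y Q \<circ> ?T" "F' \<circ> assign (g y) Q' = F \<circ> assign y Q \<circ> ?T"
        unfolding A using * by (auto simp: fun_eq_iff intro!: supportedD[OF good(1)] supportedD[OF good(2)])
    qed
    ultimately show ?thesis using hh A by blast
  qed
qed

lemma fsteps_feq:
  assumes "(fstep z)\<^sup>*\<^sup>* A B" "feq A A'" "good A"
  shows "\<exists>B'. (fstep z)\<^sup>*\<^sup>* A' B' \<and> feq B B'"
  using assms
proof (induction rule: rtranclp_induct)
  case base
  then show ?case by blast
next
  case (step B C)
  then obtain B' where B': "(fstep z)\<^sup>*\<^sup>* A' B'" "feq B B'" by auto
  moreover have "good B" using good_fsteps step by metis
  ultimately obtain C' where "fstep z B' C'" "feq C C'"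
    using fstep_feq[OF step.hyps(2)] by blast
  then show ?case using B' by (meson rtranclp.rtrancl_into_rtrancl)
qed

section \<open>Joinability modulo equivalence\<close>

definition joinable :: "'r \<Rightarrow> ('v, 'r) state \<Rightarrow> ('v, 'r) state \<Rightarrow> bool" where
  "joinable z A B \<longleftrightarrow> (\<exists>C D. (fstep z)\<^sup>*\<^sup>* A C \<and> (fstep z)\<^sup>*\<^sup>* B D \<and> feq C D)"

lemma joinable_sym: "joinable z A B \<Longrightarrow> good A \<Longrightarrow> joinable z B A"
  unfolding joinable_def using feq_sym good_fsteps by metis

lemma feq_joinable: "feq A B \<Longrightarrow> joinable z A B"
  unfolding joinable_def by blast

lemma joinable_feq:
  assumes "joinable z A B" "feq B B'" "good B" shows "joinable z A B'"
proof -
  obtain C D where D: "(fstep z)\<^sup>*\<^sup>* A C" "(fstep z)\<^sup>*\<^sup>* B D" "feq C D"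
    using assms(1) by (auto simp: joinable_def)
  then obtain D' where "(fstep z)\<^sup>*\<^sup>* B' D'" "feq D D'" using fsteps_feq assms by metis
  then show ?thesis using D feq_trans unfolding joinable_def by metis
qed

text \<open>Each side of a peak may be replaced by an equivalent state before it is joined; changes
  of pivot enter the argument this way.\<close>

lemma joinable_cong:
  assumes "feq A A'" "joinable z A' B'" "feq B B'" "good A" "good B"
  shows "joinable z A B"
proof -
  have g: "good A'" "good B'" using assms good_feq by blast+
  have "joinable z A' B" using assms g feq_sym joinable_feq by metis
  then have "joinable z B A'" using g joinable_sym by metis
  then have "joinable z B A" using assms(1,4) g feq_sym joinable_feq by metis
  then show ?thesis using assms(5) joinable_sym by metis
qed

lemma joinable_steps:
  assumes "(fstep z)\<^sup>*\<^sup>* A C" "(fstep z)\<^sup>*\<^sup>* B D" "joinable z C D" shows "joinable z A B"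
  using assms unfolding joinable_def by (meson rtranclp_trans)

lemma joinable_common: "fstep z A C \<Longrightarrow> fstep z B C \<Longrightarrow> joinable z A B"
  using joinable_steps[of z A C B C] feq_joinable[OF feq_refl[of C]] by blast


section \<open>Confluence for Boolean functions\<close>

lemma form_dep: "indep y Q \<Longrightarrow> \<not> indep y (\<lambda>v. v y + Q v)"
  by (auto simp: indep_def add_ac)

lemma indep_form:
  assumes "u \<noteq> y" shows "indep u (\<lambda>v. v y + Q v) \<longleftrightarrow> indep u Q"
  using assms by (simp add: indep_def)

lemma affine1_dep:
  assumes "affine1 V Q" "\<not> indep u Q" shows "u \<in> V \<and> (\<exists>c. Q = (\<lambda>v. v u + c))"
proof -
  have "w = u" if "Q = (\<lambda>v. v w + c)" for w c
    using assms(2) that by (auto simp: indep_def flip_def split: if_splits)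
  then show ?thesis using assms by (auto simp: affine1_def)
qed

text \<open>The only nonzero coefficient over the two-element field is 1, so the variables of an
  affine form determine it up to its constant.\<close>

lemma affine1_indepD:
  assumes "affine1 V Q" "affine1 V Q'" "\<And>u. indep u Q \<longleftrightarrow> indep u Q'"
  shows "\<exists>d. \<forall>v. Q' v = Q v + d"
proof (cases "\<exists>u. \<not> indep u Q")
  case True
  then obtain u where u: "\<not> indep u Q" "\<not> indep u Q'" using assms(3) by blast
  obtain c c' where "Q = (\<lambda>v. v u + c)" "Q' = (\<lambda>v. v u + c')"
    using affine1_dep[OF assms(1) u(1)] affine1_dep[OF assms(2) u(2)] by blast
  then show ?thesis by (intro exI[of _ "c + c'"]) (simp add: add.assoc)
next
  case False
  have const: "\<exists>c. R = (\<lambda>_. c)" if R: "affine1 V R" "\<And>u. indep u R" for R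
  proof (rule ccontr)
    assume "\<nexists>c. R = (\<lambda>_. c)"
    then obtain u c where "R = (\<lambda>v. v u + c)" using R(1) unfolding affine1_def by blast
    then show False using R(2)[of u] form_dep[OF indep_const, of u c] by simp
  qed
  obtain c where "Q = (\<lambda>_. c)" using const[OF assms(1)] False by blast
  moreover obtain c' where "Q' = (\<lambda>_. c')" using const[OF assms(2)] False assms(3) by blast
  ultimately show ?thesis by (intro exI[of _ "c + c'"]) simp
qed

lemma affine1_add_const:
  assumes "affine1 V Q" shows "affine1 V (\<lambda>v. Q v + c)"
proof -
  consider e where "Q = (\<lambda>_. e)" | u e where "u \<in> V" "Q = (\<lambda>v. v u + e)"
    using assms by (auto simp: affine1_def)
  then show ?thesis
  proof cases
    case 2
    then have "(\<lambda>v. Q v + c) = (\<lambda>v. v u + (e + c))" by (simp add: add.assoc)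
    then show ?thesis using 2(1) unfolding affine1_def by blast
  qed (auto simp: affine1_def)
qed

text \<open>Replacing the only variable of Q by a form in at most one variable again gives such a
  form: the side condition of HH survives an earlier HH step.\<close>

lemma affine1_assign:
  assumes "affine1 V Q" "affine1 V Q'" shows "affine1 V (Q \<circ> assign y Q')"
proof -
  consider c where "Q = (\<lambda>_. c)" | u c where "u \<in> V" "u \<noteq> y" "Q = (\<lambda>v. v u + c)"
    | c where "Q = (\<lambda>v. v y + c)"
    using assms(1) by (auto simp: affine1_def)
  then show ?thesis
  proof cases
    case 3
    then have *: "Q \<circ> assign y Q' = (\<lambda>v. Q' v + c)" by (simp add: fun_eq_iff assign_def)
    show ?thesis unfolding * by (rule affine1_add_const[OF assms(2)])
  qed (auto simp: affine1_def assign_def comp_def)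
qed

text \<open>Both substitutions solve y + y' + c = 0, for y and for y' respectively. Exchanging y and
  y' while adding c to both carries one solution to the other.\<close>

lemma feq_swap:
  assumes "y \<in> W" "y' \<in> W" "y \<noteq> y'"
  shows "feq (W, s, P \<circ> assign y (\<lambda>v. v y' + c), F \<circ> assign y (\<lambda>v. v y' + c))
    (W, s, P \<circ> assign y' (\<lambda>v. v y + c), F \<circ> assign y' (\<lambda>v. v y + c))"
proof (rule feq.intros)
  let ?g = "\<lambda>u. if u = y then y' else if u = y' then y else u"
  let ?T = "affine_map ?g (\<lambda>u. if u \<in> {y, y'} then c else 0)"
  show "bij_betw ?g W W"
    using assms by (intro bij_betw_byWitness[of W ?g]) auto
  have *: "assign y' (\<lambda>v. v y + c) = assign y (\<lambda>v. v y' + c) \<circ> ?T"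
    using assms(3) by (auto simp: fun_eq_iff assign_def affine_map_def add.assoc)
  show "f \<circ> assign y' (\<lambda>v. v y + c) = f \<circ> assign y (\<lambda>v. v y' + c) \<circ> ?T" for f :: "_ \<Rightarrow> bit"
    unfolding * by (simp add: comp_assoc)
  show "f \<circ> assign y' (\<lambda>v. v y + c) = f \<circ> assign y (\<lambda>v. v y' + c) \<circ> ?T" for f :: "_ \<Rightarrow> 'b"
    unfolding * by (simp add: comp_assoc)
qed

text \<open>If the pivots differ, y' must occur in Q, so the common form is y + y' + c and
  \<open>feq_swap\<close> applies.\<close>

lemma feq_form:
  assumes "affine1 U Q" "indep y Q" "indep y' Q'" "y \<in> W" "y' \<in> W"
    and eq: "\<And>v. v y + Q v = v y' + Q' v"
  shows "feq (W, s, P \<circ> assign y Q, F \<circ> assign y Q) (W, s, P \<circ> assign y' Q', F \<circ> assign y' Q')"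
proof (cases "y = y'")
  case True
  then have "Q = Q'" using eq by (auto simp: fun_eq_iff)
  then show ?thesis using True feq_refl by simp
next
  case False
  have "\<not> indep y' (\<lambda>v. v y + Q v)" unfolding eq by (rule form_dep[OF assms(3)])
  then have "\<not> indep y' Q" using False indep_form by metis
  then obtain c where c: "Q = (\<lambda>v. v y' + c)" using affine1_dep[OF assms(1)] by blast
  have "Q' v = v y + c" for v
    using eq[of v] unfolding c by (cases "Q' v"; cases "v y"; cases "v y'"; cases c; simp)
  then have "Q' = (\<lambda>v. v y + c)" by auto
  then show ?thesis unfolding c using feq_swap assms(4,5) False by simp
qed

text \<open>Any variable u of the form L = y + Q can be the pivot: the new Q is u + L, which is L
  with u cancelled, and for u = y it is Q again.\<close>

lemma pivot_change:
  assumes p: "pivot V P F x y Q" and u: "\<not> indep u (\<lambda>v. v y + Q v)"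
  shows "pivot V P F x u (\<lambda>v. v u + (v y + Q v))"
    "feq (V - {x}, s, P \<circ> assign y Q, F \<circ> assign y Q)
      (V - {x}, s, P \<circ> assign u (\<lambda>v. v u + (v y + Q v)), F \<circ> assign u (\<lambda>v. v u + (v y + Q v)))"
proof -
  note p' = pivotD[OF p]
  let ?Q = "\<lambda>v. v u + (v y + Q v)"
  have a: "affine1 V ?Q \<and> indep u ?Q \<and> u \<in> V"
  proof (cases "u = y")
    case True
    then show ?thesis using p' by simp
  next
    case False
    then have "\<not> indep u Q" using u indep_form by metis
    then obtain c where "u \<in> V" "Q = (\<lambda>v. v u + c)" using affine1_dep p'(4) by metis
    then have "u \<in> V" "?Q = (\<lambda>v. v y + c)"
      by (auto simp: fun_eq_iff add.left_commute)
    then show ?thesis using False p'(2) by (auto simp: affine1_def indep_def)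
  qed
  then show q: "pivot V P F x u ?Q" using p' by (simp add: pivot_def)
  show "feq (V - {x}, s, P \<circ> assign y Q, F \<circ> assign y Q)
      (V - {x}, s, P \<circ> assign u ?Q, F \<circ> assign u ?Q)"
    using p' a pivotD(6)[OF q] by (intro feq_form) auto
qed

text \<open>
  Two HH steps with coefficients \<open>L = y + Q\<close> and \<open>L' = y' + Q'\<close> of distinct \<open>x\<close>, \<open>x'\<close> overlap in one
  of three ways: \<open>P\<close> contains \<open>x x'\<close> (\<open>join_linked\<close>); \<open>L\<close> and \<open>L'\<close> have the same variables
  and so differ by a constant (\<open>join_parallel\<close>); or some variable of one is absent from the
  other, and serves as pivot (\<open>join_disjoint\<close>).
\<close>

lemma join_disjoint:
  assumes p: "pivot V P F x y Q" and p': "pivot V P F x' y' Q'" and "x \<noteq> x'"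
    and i: "indep x' (\<lambda>v. v y + Q v)" "indep x (\<lambda>v. v y' + Q' v)"
    and y: "indep y (\<lambda>v. v y' + Q' v)"
  shows "joinable z (V - {x}, s, P \<circ> assign y Q, F \<circ> assign y Q)
    (V - {x'}, s, P \<circ> assign y' Q', F \<circ> assign y' Q')"
proof -
  note d = pivotD[OF p] and d' = pivotD[OF p']
  have neq: "y \<noteq> y'" "x' \<noteq> y" "x \<noteq> y'" using y i form_dep d(5) d'(5) by metis+
  then have ind: "indep y Q'" "indep x' Q" "indep x Q'" using y i indep_form by metis+
  have "pivot (V - {x}) (P \<circ> assign y Q) (F \<circ> assign y Q) x' y' Q'"
    unfolding pivot_def
  proof (intro conjI allI)
    show "indep x' (F \<circ> assign y Q)" using d' neq ind by (intro indep_assign)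
    show "affine1 (V - {x}) Q'" using d' ind by (intro affine1_remove)
    fix v
    show "(P \<circ> assign y Q) (flip x' v) = (P \<circ> assign y Q) v + (v y' + Q' v)"
      using neq ind by (simp add: assign_flip d'(8)) (simp add: assign_def indep_update)
  qed (use d' \<open>x \<noteq> x'\<close> neq in auto)
  \<comment> \<open>The situation is triangular: y is absent from Q', but y' may occur in Q. Hence
    the other order has to use Q after the substitution y' <- Q'.\<close>
  moreover have "pivot (V - {x'}) (P \<circ> assign y' Q') (F \<circ> assign y' Q') x y (Q \<circ> assign y' Q')"
    unfolding pivot_def
  proof (intro conjI allI)
    show "indep x (F \<circ> assign y' Q')" using d neq ind by (intro indep_assign)
    show "affine1 (V - {x'}) (Q \<circ> assign y' Q')"
      using d d' ind by (intro affine1_assign affine1_remove)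
    show "indep y (Q \<circ> assign y' Q')" using d neq ind by (intro indep_assign)
    fix v
    show "(P \<circ> assign y' Q') (flip x v) = (P \<circ> assign y' Q') v + (v y + (Q \<circ> assign y' Q') v)"
      using neq ind by (simp add: assign_flip d(8)) (simp add: assign_def)
  qed (use d \<open>x \<noteq> x'\<close> neq in auto)
  moreover have "assign y' Q' \<circ> assign y (Q \<circ> assign y' Q') = assign y Q \<circ> assign y' Q'"
    using neq ind by (auto simp: fun_eq_iff assign_def indep_update)
  moreover have "V - {x} - {x'} = V - {x'} - {x}" by blast
  ultimately show ?thesis
    using fstep.hh[of "V - {x}" "P \<circ> assign y Q" "F \<circ> assign y Q" x' y' Q' z s]
      fstep.hh[of "V - {x'}" "P \<circ> assign y' Q'" "F \<circ> assign y' Q'" x y "Q \<circ> assign y' Q'" z s]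
    by (intro joinable_common) (simp_all add: comp_assoc)
qed

lemma join_linked:
  assumes p: "pivot V P F x x' Q" and p': "pivot V P F x' x Q'"
  shows "joinable z (V - {x}, s, P \<circ> assign x' Q, F \<circ> assign x' Q)
    (V - {x'}, s, P \<circ> assign x Q', F \<circ> assign x Q')"
proof -
  note d = pivotD[OF p] and d' = pivotD[OF p']
  have F: "F \<circ> assign x' Q = F" "F \<circ> assign x Q' = F"
    using d(3) d'(3) by (auto simp: assign_def indep_update)
  \<comment> \<open>This reduct no longer depends on x, so x may be set to Q'. The other reduct
    likewise permits x' to be set to Q, and both become P evaluated at x = Q', x' = Q.\<close>
  have "P (assign x' Q v) = P (v(x := Q' v, x' := Q v))" for v
    using indep_update[OF pivot_indep(1)[OF p], of v "Q' v"] d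
    by (simp add: assign_def indep_update)
  moreover have "P (assign x Q' v) = P (v(x' := Q v, x := Q' v))" for v
    using indep_update[OF pivot_indep(1)[OF p'], of v "Q v"] d'
    by (simp add: assign_def indep_update)
  ultimately have P: "P \<circ> assign x Q' = P \<circ> assign x' Q"
    using d(6) by (simp add: fun_eq_iff fun_upd_twist)
  have V: "V - {x} - {x'} = V - {x'} - {x}" by blast
  show ?thesis unfolding F
  proof (rule joinable_common)
    show "fstep z (V - {x}, s, P \<circ> assign x' Q, F) (V - {x'} - {x}, 2 * s, P \<circ> assign x' Q, F)"
      unfolding V[symmetric] using d d' indep_assign_same[OF d(5)] by (intro fstep.elim) auto
    show "fstep z (V - {x'}, s, P \<circ> assign x Q', F) (V - {x'} - {x}, 2 * s, P \<circ> assign x' Q, F)"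
      unfolding P[symmetric] using d d' indep_assign_same[OF d'(5)] by (intro fstep.elim) auto
  qed
qed

lemma join_parallel:
  assumes p: "pivot V P F x y Q" and p': "pivot V P F x' y Q'" and "x \<noteq> x'"
    and Q': "\<And>v. Q' v = Q v + d"
  shows "joinable z (V - {x}, s, P \<circ> assign y Q, F \<circ> assign y Q)
    (V - {x'}, s, P \<circ> assign y Q', F \<circ> assign y Q')"
proof (cases "d = 0")
  case True
  \<comment> \<open>With equal forms the substitution kills both derivatives, so whichever of x and
    x' is left falls to Elim.\<close>
  then have [simp]: "Q' = Q" using Q' by auto
  have "V - {x} - {x'} = V - {x'} - {x}" by blast
  then show ?thesis
    using fstep.elim[of x' "V - {x}" "P \<circ> assign y Q" "F \<circ> assign y Q" z s]
      fstep.elim[of x "V - {x'}" "P \<circ> assign y Q" "F \<circ> assign y Q" z s]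
      pivot_indep[OF p] pivot_indep[OF p'] pivotD(1)[OF p] pivotD(1)[OF p'] \<open>x \<noteq> x'\<close>
    by (intro joinable_common) auto
next
  case False
  then have 1: "d = 1" by (cases d) simp_all
  \<comment> \<open>The two forms differ by 1, so making one vanish turns the derivative along the
    remaining variable into 1, and Z applies. The names are kept general because both orders are
    needed.\<close>
  have z: "fstep z (V - {x}, s, P \<circ> assign y Q, F \<circ> assign y Q) ({}, 0, \<lambda>_. 0, \<lambda>_. z)"
    if p: "pivot V P F x y Q" and p': "pivot V P F x' y Q'" and "x \<noteq> x'"
      and Q': "\<And>v. Q' v = Q v + 1" for x x' Q Q'
  proof (rule fstep.zero)
    note d = pivotD[OF p] and d' = pivotD[OF p']
    show "x' \<in> V - {x}" using that d' by auto
    have "Q = (\<lambda>v. Q' v + 1)" using Q' by (auto simp: add.assoc)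
    then have i: "indep x' Q" using d'(7) by (simp add: indep_def)
    then show "indep x' (F \<circ> assign y Q)" using d' by (intro indep_assign) auto
    show "\<forall>v. (P \<circ> assign y Q) (flip x' v) = (P \<circ> assign y Q) v + 1"
      using i d' by (simp add: assign_flip Q') (metis add.assoc add.left_neutral assign_form d(5))
  qed
  have "Q v = Q' v + 1" for v using Q' 1 by (simp add: add.assoc)
  then show ?thesis using Q' z[OF p p'] z[OF p' p] \<open>x \<noteq> x'\<close> 1
    by (intro joinable_common) auto
qed

lemma join_hh_hh:
  assumes p: "pivot V P F x y Q" and p': "pivot V P F x' y' Q'"
    and g: "good (V, s, P, F)"
  shows "joinable z (V - {x}, s, P \<circ> assign y Q, F \<circ> assign y Q)
    (V - {x'}, s, P \<circ> assign y' Q', F \<circ> assign y' Q')"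
    (is "joinable z (?A x y Q) (?A x' y' Q')")
proof -
  note d = pivotD[OF p] and d' = pivotD[OF p']
  let ?L = "\<lambda>v. v y + Q v" and ?L' = "\<lambda>v. v y' + Q' v"
  have ga: "good (?A x y Q)" "good (?A x' y' Q')"
    using good_fstep fstep.hh p p' g by metis+
  show ?thesis
  proof (cases "x = x'")
    case True
    then have "?L v = ?L' v" for v using d(8)[of v] d'(8)[of v] by simp
    then show ?thesis using d d' True
      by (intro feq_joinable) (auto intro!: feq_form)
  next
    case x: False
    \<comment> \<open>Both sides are the mixed second difference of P in x and x'. Hence x' occurs
      in L exactly when x occurs in L'.\<close>
    have comm: "?L (flip x' v) + ?L v = ?L' (flip x v) + ?L' v" for v
      using d(8)[of "flip x' v"] d(8)[of v] d'(8)[of "flip x v"] d'(8)[of v] flip_commute[of x x' v]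
      by (cases "?L v"; cases "?L' v"; cases "?L (flip x' v)"; cases "?L' (flip x v)"; cases "P v") simp_all
    have ii: "indep x' ?L \<longleftrightarrow> indep x ?L'"
      using comm bit_swap unfolding indep_def by (metis bit_cancel(1))
    consider "\<not> indep x' ?L" "\<not> indep x ?L'"
      | u where "indep x' ?L" "indep x ?L'" "\<not> indep u ?L" "indep u ?L'"
      | u where "indep x' ?L" "indep x ?L'" "indep u ?L" "\<not> indep u ?L'"
      | "indep x' ?L" "indep x ?L'" "\<And>u. indep u ?L \<longleftrightarrow> indep u ?L'"
      using ii by blast
    then show ?thesis
    proof cases
      case 1
      \<comment> \<open>Each of x and x' occurs in the form belonging to the other, so both steps
        can be given the crossed pivots.\<close>
      show ?thesis
        by (rule joinable_cong[OF pivot_change(2)[OF p 1(1)] join_linked[OF pivot_change(1)[OF p 1(1)]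
              pivot_change(1)[OF p' 1(2)]] pivot_change(2)[OF p' 1(2)] ga])
    next
      case 2
      show ?thesis
        by (rule joinable_cong[OF pivot_change(2)[OF p 2(3)] join_disjoint[OF pivot_change(1)[OF p 2(3)] p' x]
            feq_refl ga]) (use 2 in simp_all)
    next
      case 3
      have "joinable z (?A x' y' Q') (?A x y Q)"
        by (rule joinable_cong[OF pivot_change(2)[OF p' 3(4)] join_disjoint[OF pivot_change(1)[OF p' 3(4)] p]
            feq_refl ga(2,1)]) (use 3 x in simp_all)
      then show ?thesis using ga joinable_sym by metis
    next
      case 4
      \<comment> \<open>The variable y occurs in L, hence in L', and can be the pivot on both sides.
        With this common pivot removed, the remainders still have equal variables and so differ by a
        constant.\<close>
      then have y: "\<not> indep y ?L'" using form_dep d(5) by metis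
      let ?Q = "\<lambda>v. v y + ?L' v"
      note q = pivot_change[OF p' y]
      have "indep u Q \<longleftrightarrow> indep u ?Q" for u
      proof (cases "u = y")
        case True
        then show ?thesis using d(5) pivotD(5)[OF q(1)] by simp
      next
        case False
        then show ?thesis using 4(3)[of u] indep_form[OF False, of Q] indep_form[OF False, of ?L'] by simp
      qed
      then obtain e where "\<And>v. ?Q v = Q v + e"
        using affine1_indepD[OF d(4) pivotD(4)[OF q(1)]] by blast
      then show ?thesis
        using joinable_cong[OF feq_refl join_parallel[OF p q(1) x] q(2) ga] by blast
    qed
  qed
qed

section \<open>Overlaps involving Elim or Z\<close>

lemma join_elim_hh:
  assumes "w \<in> V" "indep w P" "indep w F" and p: "pivot V P F x y Q"
  shows "joinable z (V - {w}, 2 * s, P, F) (V - {x}, s, P \<circ> assign y Q, F \<circ> assign y Q)"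
proof -
  note d = pivotD[OF p]
  \<comment> \<open>As P is free of w, so is its derivative along x. Nonconstancy of that derivative
    then separates w from x, and the two steps commute.\<close>
  have L: "indep w (\<lambda>v. v y + Q v)"
    using d(8) assms(2) flip_commute[of x w] unfolding indep_def by (metis add_left_cancel)
  then have "w \<noteq> y" using form_dep d(5) by metis
  moreover from this have i: "indep w Q" using L indep_form by metis
  moreover have "w \<noteq> x"
  proof
    assume "w = x"
    then have "v y + Q v = 0" for v using d(8)[of v] assms(2) by (simp add: indep_def)
    then show False using form_dep[OF d(5)] by (simp add: indep_def)
  qed
  ultimately have "pivot (V - {w}) P F x y Q"
    using d by (auto simp: pivot_def intro: affine1_remove)
  moreover have "indep w (P \<circ> assign y Q)" "indep w (F \<circ> assign y Q)"
    using assms i \<open>w \<noteq> y\<close> by (auto intro: indep_assign)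
  moreover have "V - {w} - {x} = V - {x} - {w}" by blast
  ultimately show ?thesis
    using fstep.hh[of "V - {w}" P F x y Q z "2 * s"] \<open>w \<noteq> x\<close> assms(1)
      fstep.elim[of w "V - {x}" "P \<circ> assign y Q" "F \<circ> assign y Q" z s]
    by (intro joinable_common) auto
qed

lemma join_zero_hh:
  assumes "w \<in> V" "\<forall>v. P (flip w v) = P v + 1" "indep w F" and p: "pivot V P F x y Q"
  shows "joinable z ({}, 0, \<lambda>_. 0, \<lambda>_. z) (V - {x}, s, P \<circ> assign y Q, F \<circ> assign y Q)"
proof -
  note d = pivotD[OF p]
  \<comment> \<open>The derivative along w is constant, so the mixed difference with x is zero and w
    is absent from y + Q. After HH the derivative along w is therefore still 1.\<close>
  have L: "indep w (\<lambda>v. v y + Q v)"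
    unfolding indep_def
  proof
    fix v
    show "flip w v y + Q (flip w v) = v y + Q v"
      using d(8)[of "flip w v"] d(8)[of v] assms(2) flip_commute[of x w v]
      by (cases "v y + Q v"; cases "flip w v y + Q (flip w v)"; cases "P v") simp_all
  qed
  then have "w \<noteq> y" using form_dep d(5) by metis
  moreover from this have i: "indep w Q" using L indep_form by metis
  moreover have "w \<noteq> x"
  proof
    assume "w = x"
    then have "v y + Q v = 1" for v using d(8)[of v] assms(2) by simp
    then show False using form_dep[OF d(5)] by (simp add: indep_def)
  qed
  ultimately have "fstep z (V - {x}, s, P \<circ> assign y Q, F \<circ> assign y Q) ({}, 0, \<lambda>_. 0, \<lambda>_. z)"
    using assms by (intro fstep.zero[of w]) (auto simp: assign_flip intro: indep_assign)
  then show ?thesis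
    using joinable_steps[OF _ r_into_rtranclp[of "fstep z"] feq_joinable[OF feq_refl]] by blast
qed

lemma join_elim_zero:
  assumes "w \<in> V" "indep w P" "indep w F" "x \<in> V" "\<forall>v. P (flip x v) = P v + 1" "indep x F"
  shows "joinable z (V - {w}, 2 * s, P, F) ({}, 0, \<lambda>_. 0, \<lambda>_. z)"
proof -
  have "w \<noteq> x" using assms by (auto simp: indep_def)
  then have "fstep z (V - {w}, 2 * s, P, F) ({}, 0, \<lambda>_. 0, \<lambda>_. z)"
    using assms by (intro fstep.zero[of x]) auto
  then show ?thesis
    using joinable_steps[OF r_into_rtranclp[of "fstep z"] _ feq_joinable[OF feq_refl]] by blast
qed

lemma join_elim_elim:
  assumes "w \<in> V" "indep w P" "indep w F" "x \<in> V" "indep x P" "indep x F"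
  shows "joinable z (V - {w}, 2 * s, P, F) (V - {x}, 2 * s, P, F)"
proof (cases "w = x")
  case True
  then show ?thesis using feq_joinable[OF feq_refl] by simp
next
  case False
  have "V - {w} - {x} = V - {x} - {w}" by blast
  then show ?thesis
    using False assms fstep.elim[of x "V - {w}" P F z "2 * s"] fstep.elim[of w "V - {x}" P F z "2 * s"]
    by (intro joinable_common) auto
qed

lemma local_confluence:
  assumes "fstep z A B" "fstep z A C" "good A" shows "joinable z B C"
  using assms(1)
proof cases
  case (elim x V P F s)
  note B = elim
  from assms(2)[unfolded B(1)] show ?thesis
  proof cases
    case (elim x') then show ?thesis using B join_elim_elim by simp
  next
    case zero then show ?thesis using B join_elim_zero by simp
  next
    case hh then show ?thesis using B join_elim_hh by simp
  qed
next
  case (zero x V P F s)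
  note B = zero
  from assms(2)[unfolded B(1)] show ?thesis
  proof cases
    case (elim x')
    then have "joinable z C B" using B join_elim_zero by simp
    then show ?thesis using assms good_fstep joinable_sym by metis
  next
    case zero then show ?thesis using B feq_joinable[OF feq_refl] by simp
  next
    case hh then show ?thesis using B join_zero_hh by simp
  qed
next
  case (hh V P F x y Q s)
  note B = hh
  from assms(2)[unfolded B(1)] show ?thesis
  proof cases
    case (elim x')
    then have "joinable z C B" using B join_elim_hh by simp
    then show ?thesis using assms good_fstep joinable_sym by metis
  next
    case (zero x')
    then have "joinable z C B" using B join_zero_hh by simp
    then show ?thesis using assms good_fstep joinable_sym by metis
  next
    case hh then show ?thesis using B join_hh_hh assms(3) by simp
  qed
qed

section \<open>From local to global confluence modulo equivalence\<close>

lemma fstep_card: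
  fixes A B :: "('v, 'r) state"
  assumes "fstep z A B" "good A" shows "card (fst B) < card (fst A)"
proof -
  have "card (V - {x}) < card V" if "finite V" "x \<in> V" for V and x :: 'v
    using that by (rule card_Diff1_less)
  with assms show ?thesis by cases (auto simp: pivot_def card_gt_0_iff simp del: card_Diff_singleton)
qed

lemma confluence:
  assumes "(fstep z)\<^sup>*\<^sup>* A B" "(fstep z)\<^sup>*\<^sup>* A C" "good A" shows "joinable z B C"
  using assms
proof (induction "card (fst A)" arbitrary: A B C rule: less_induct)
  case less
  show ?case
  proof (cases "A = B \<or> A = C")
    case True
    then show ?thesis
      using less.prems(1,2) feq_refl[of B] feq_refl[of C] unfolding joinable_def by blast
  next
    case False
    then obtain B1 C1 where 1: "fstep z A B1" "(fstep z)\<^sup>*\<^sup>* B1 B" "fstep z A C1" "(fstep z)\<^sup>*\<^sup>* C1 C"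
      using converse_rtranclpE[OF less.prems(1)] converse_rtranclpE[OF less.prems(2)] by metis
    then have g1: "good B1" "good C1" using good_fstep[OF _ less.prems(3)] by metis+
    obtain E F where EF: "(fstep z)\<^sup>*\<^sup>* B1 E" "(fstep z)\<^sup>*\<^sup>* C1 F" "feq E F"
      using local_confluence[OF 1(1,3) less.prems(3)] by (auto simp: joinable_def)
    have g: "good B" "good C" "good E" "good F" using good_fsteps[OF 1(2)] good_fsteps[OF 1(4)] good_fsteps[OF EF(1)] good_fsteps[OF EF(2)] g1 by simp_all
    have "joinable z B E"
      using less.hyps[OF fstep_card[OF 1(1) less.prems(3)] 1(2) EF(1) g1(1)] .
    then have "joinable z B F" using joinable_feq[OF _ EF(3) g(3)] by simp
    then obtain B2 F2 where 2: "(fstep z)\<^sup>*\<^sup>* B B2" "(fstep z)\<^sup>*\<^sup>* F F2" "feq B2 F2"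
      by (auto simp: joinable_def)
    have g2: "good B2" "good F2" using good_fsteps[OF 2(1)] good_fsteps[OF 2(2)] g by simp_all
    \<comment> \<open>The second use of the induction hypothesis, at C1, compares C with F2 instead
      of F: F2 is already equivalent to a reduct of B, so closing this peak also closes the one
      between B and C.\<close>
    have "joinable z C F2"
      using less.hyps[OF fstep_card[OF 1(3) less.prems(3)] 1(4) rtranclp_trans[OF EF(2) 2(2)] g1(2)] .
    then have "joinable z C B2" using joinable_feq[OF _ feq_sym[OF 2(3) g2(1)] g2(2)] by simp
    then show ?thesis
      using joinable_steps[OF 2(1) rtranclp.rtrancl_refl joinable_sym[OF _ g(2)]] by simp
  qed
qed

text \<open>The reduction of B is replayed from A up to equivalence, which leaves a peak with the
  single source A.\<close>

lemma confluence_modulo: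
  assumes "feq A B" "(fstep z)\<^sup>*\<^sup>* A C" "(fstep z)\<^sup>*\<^sup>* B D" "good A" shows "joinable z C D"
proof -
  have g: "good B" "good C" "good D" using assms good_feq good_fsteps by metis+
  obtain D' where D': "(fstep z)\<^sup>*\<^sup>* A D'" "feq D D'"
    using fsteps_feq[OF assms(3) feq_sym[OF assms(1,4)] g(1)] by blast
  then have "joinable z C D'" using confluence assms by metis
  moreover have "feq D' D" "good D'" using D' g feq_sym good_feq by metis+
  ultimately show ?thesis using joinable_feq by metis
qed


section \<open>Evaluation of polynomials\<close>

text \<open>One evaluation serves two purposes: with the identity on \<open>bit\<close> it computes
  values at points, and with the embedding of constants into \<open>'v poly2\<close> it is
  substitution.\<close>

locale bit_hom =
  fixes h :: "bit \<Rightarrow> 'a::comm_ring_1"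
  assumes h_0: "h 0 = 0" and h_1: "h 1 = 1" and h_add: "h (a + b) = h a + h b"
begin

lemma h_mult: "h (a * b) = h a * h b"
  by (cases a; cases b) (simp_all add: h_0 h_1)

definition meval :: "('v \<Rightarrow> 'a) \<Rightarrow> ('v \<Rightarrow>\<^sub>0 nat) \<Rightarrow> 'a" where
  "meval \<sigma> m = (\<Prod>v\<in>Poly_Mapping.keys m. \<sigma> v ^ Poly_Mapping.lookup m v)"

definition peval :: "('v \<Rightarrow> 'a) \<Rightarrow> 'v poly2 \<Rightarrow> 'a" where
  "peval \<sigma> p = (\<Sum>m\<in>Poly_Mapping.keys p. h (Poly_Mapping.lookup p m) * meval \<sigma> m)"

lemma meval_superset:
  assumes "finite S" "Poly_Mapping.keys m \<subseteq> S"
  shows "meval \<sigma> m = (\<Prod>v\<in>S. \<sigma> v ^ Poly_Mapping.lookup m v)"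
  unfolding meval_def using assms
  by (intro prod.mono_neutral_left) (auto simp: in_keys_iff)

lemma meval_add: "meval \<sigma> (m + n) = meval \<sigma> m * meval \<sigma> n"
proof -
  let ?S = "Poly_Mapping.keys m \<union> Poly_Mapping.keys n"
  have "Poly_Mapping.keys (m + n) \<subseteq> ?S" by (rule keys_add)
  then show ?thesis
    by (simp add: meval_superset[of ?S] lookup_add power_add prod.distrib)
qed

lemma peval_superset:
  assumes "finite S" "Poly_Mapping.keys p \<subseteq> S"
  shows "peval \<sigma> p = (\<Sum>m\<in>S. h (Poly_Mapping.lookup p m) * meval \<sigma> m)"
  unfolding peval_def using assms
  by (intro sum.mono_neutral_left) (auto simp: in_keys_iff h_0)

lemma peval_add: "peval \<sigma> (p + q) = peval \<sigma> p + peval \<sigma> q"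
proof -
  let ?S = "Poly_Mapping.keys p \<union> Poly_Mapping.keys q"
  have "Poly_Mapping.keys (p + q) \<subseteq> ?S" by (rule keys_add)
  then show ?thesis
    by (simp add: peval_superset[of ?S] lookup_add h_add distrib_right sum.distrib)
qed

lemma peval_0 [simp]: "peval \<sigma> 0 = 0"
  by (simp add: peval_def)

lemma peval_single: "peval \<sigma> (Poly_Mapping.single m c) = h c * meval \<sigma> m"
  by (simp add: peval_def h_0)

lemma peval_mult: "peval \<sigma> (p * q) = peval \<sigma> p * peval \<sigma> q"
proof (induction p rule: poly_mapping_additive_induct)
  case (single m c)
  show ?case
    by (induction q rule: poly_mapping_additive_induct)
       (simp_all only: peval_0 peval_add distrib_left mult_single peval_single meval_add h_mult
          distrib_right mult_zero_left mult_zero_right mult_ac)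
qed (auto simp: distrib_right peval_add)

lemma peval_const [simp]: "peval \<sigma> (Poly_Mapping.single 0 c) = h c"
  by (simp add: peval_single meval_def)

lemma peval_1 [simp]: "peval \<sigma> 1 = 1"
  using peval_const[of \<sigma> 1] by (simp add: h_1)

lemma peval_ind [simp]: "peval \<sigma> (ind v) = \<sigma> v"
  by (simp add: ind_def peval_single h_1 meval_def)

end

interpretation bit: bit_hom "\<lambda>b. b" by unfold_locales auto

interpretation const: bit_hom "Poly_Mapping.single 0 :: bit \<Rightarrow> 'v poly2"
  by unfold_locales (auto simp: single_add)

lemma vars_subsetI:
  "vars p \<subseteq> V \<Longrightarrow> vars q \<subseteq> V \<Longrightarrow> vars (p + q) \<subseteq> V"
  "vars p \<subseteq> V \<Longrightarrow> vars q \<subseteq> V \<Longrightarrow> vars (p * q) \<subseteq> V"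
  "vars p \<subseteq> V \<Longrightarrow> vars (ml p) \<subseteq> V"
  using vars_add[of p q] vars_mult[of p q] vars_ml[of p] by auto

text \<open>The cases use ring operations and variables of V only, so the rule also applies to an
  abstract ring homomorphism known on the variables.\<close>

lemma poly2_induct [consumes 1, case_names zero one add mult]:
  fixes p :: "'v poly2"
  assumes "vars p \<subseteq> V" "P 0" "P 1"
    and add: "\<And>p q. vars p \<subseteq> V \<Longrightarrow> vars q \<subseteq> V \<Longrightarrow> P p \<Longrightarrow> P q \<Longrightarrow> P (p + q)"
    and mult: "\<And>v p. v \<in> V \<Longrightarrow> vars p \<subseteq> V \<Longrightarrow> P p \<Longrightarrow> P (ind v * p)"
  shows "P p"
proof -
  define P' where "P' p \<longleftrightarrow> vars p \<subseteq> V \<and> P p" for p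
  have P': "P' 0" "P' 1" "P' p \<Longrightarrow> P' q \<Longrightarrow> P' (p + q)" "v \<in> V \<Longrightarrow> P' p \<Longrightarrow> P' (ind v * p)" for p q v
    using assms vars_add[of p q] vars_mult[of "ind v" p] by (auto simp: P'_def)
  \<comment> \<open>Monomials are handled as multiplication operators: preserving \<open>P'\<close>
    composes under products, which matches additive induction on the exponent.\<close>
  have mono: "\<forall>p. P' p \<longrightarrow> P' (Poly_Mapping.single m 1 * p)" if "Poly_Mapping.keys m \<subseteq> V" for m
  proof (induction m rule: poly_mapping_additive_induct)
    case zero
    then show ?case by simp
  next
    case (single v k)
    then have v: "v \<in> V" using that by blast
    have "P' (Poly_Mapping.single (Poly_Mapping.single v k) 1 * p)" if "P' p" for p
    proof (induction k)
      case 0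
      then show ?case using that by simp
    next
      case (Suc k)
      have "Poly_Mapping.single (Poly_Mapping.single v (Suc k)) (1::bit) =
          ind v * Poly_Mapping.single (Poly_Mapping.single v k) 1"
        by (simp add: ind_def mult_single single_add[symmetric])
      then show ?case using P'(4)[OF v Suc] by (simp add: mult.assoc)
    qed
    then show ?case by blast
  next
    case (add m n)
    have "Poly_Mapping.single (m + n) (1::bit) = Poly_Mapping.single m 1 * Poly_Mapping.single n 1"
      by (simp add: mult_single)
    then show ?case using add by (simp add: mult.assoc)
  qed
  have "P' p"
  proof (induction p rule: poly_mapping_additive_induct)
    case (single m c)
    then have "c = 1" "Poly_Mapping.keys m \<subseteq> V" using assms(1) by (auto simp: vars_def)
    then show ?case using mono[of m] P'(2) by (metis mult.right_neutral)
  qed (use P' in auto)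
  then show ?thesis by (simp add: P'_def)
qed

section \<open>Boolean polynomials as functions\<close>

definition ev :: "'v poly2 \<Rightarrow> ('v \<Rightarrow> bit) \<Rightarrow> bit" where
  "ev p v = bit.peval v p"

lemma ev_simps [simp]:
  "ev 0 v = 0" "ev 1 v = 1" "ev (p + q) v = ev p v + ev q v" "ev (p * q) v = ev p v * ev q v"
  "ev (ind x) v = v x" "ev (Poly_Mapping.single 0 c) v = c"
  by (simp_all add: ev_def bit.peval_add bit.peval_mult)

lemma supported_ev: "vars p \<subseteq> V \<Longrightarrow> supported V (ev p)"
  unfolding supported_def ev_def bit.peval_def bit.meval_def
  by (intro allI impI sum.cong prod.cong arg_cong2[where f = "(*)"] arg_cong2[where f = power])
     (auto simp: vars_def)

lemma ev_ml [simp]: "ev (ml p) = ev p"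
proof -
  have pow: "(b::bit) ^ min (Suc 0) k = b ^ k" for b k
    by (cases b; cases k) auto
  have "ev (ml p) v = ev p v" for v
  proof (induction p rule: poly_mapping_additive_induct)
    case (single m c)
    have "bit.meval v (trunc m) = bit.meval v m"
      unfolding bit.meval_def keys_trunc lookup_trunc One_nat_def by (intro prod.cong refl pow)
    then show ?case by (simp add: ev_def bit.peval_single)
  qed (simp_all add: ml_add)
  then show ?thesis by auto
qed

lemma ev_red: "vars p \<subseteq> V \<Longrightarrow> ev (red V p) = ev p"
  by (simp add: red_eq_ml)

text \<open>Evaluation at the indicator of the support of a smallest monomial m isolates its
  coefficient. Any other monomial nonzero there would have its support inside that of m, hence equal
  to it by minimality, and would be m by multilinearity.\<close>

lemma ev_eq_0D:
  assumes "multilinear p" "\<And>v. ev p v = 0" shows "p = 0"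
proof (rule ccontr)
  assume "p \<noteq> 0"
  then have "Poly_Mapping.keys p \<noteq> {}" by simp
  then obtain m where m: "m \<in> Poly_Mapping.keys p"
    and min: "\<And>n. n \<in> Poly_Mapping.keys p \<Longrightarrow>
      card (Poly_Mapping.keys m) \<le> card (Poly_Mapping.keys n)"
    using ex_has_least_nat[of "\<lambda>m. m \<in> Poly_Mapping.keys p" _ "\<lambda>m. card (Poly_Mapping.keys m)"]
    by blast
  define v :: "'a \<Rightarrow> bit" where "v = (\<lambda>x. if x \<in> Poly_Mapping.keys m then 1 else 0)"
  have zero: "bit.meval v n = 0" if n: "n \<in> Poly_Mapping.keys p" "n \<noteq> m" for n
  proof -
    have "\<not> Poly_Mapping.keys n \<subseteq> Poly_Mapping.keys m"
    proof
      assume "Poly_Mapping.keys n \<subseteq> Poly_Mapping.keys m"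
      then have keys: "Poly_Mapping.keys n = Poly_Mapping.keys m"
        using min[OF n(1)] by (metis card_seteq finite_keys)
      have "Poly_Mapping.lookup n x = Poly_Mapping.lookup m x" for x
      proof (cases "x \<in> Poly_Mapping.keys m")
        case True
        then have "Poly_Mapping.lookup n x \<noteq> 0" "Poly_Mapping.lookup m x \<noteq> 0"
          using keys by (auto simp: in_keys_iff)
        moreover have "Poly_Mapping.lookup n x \<le> 1" "Poly_Mapping.lookup m x \<le> 1"
          using assms(1) n(1) m by (auto simp: multilinear_def)
        ultimately show ?thesis by linarith
      next
        case False
        then show ?thesis using keys by (metis in_keys_iff)
      qed
      then show False using n(2) by (simp add: poly_mapping_eqI)
    qed
    then obtain x where "x \<in> Poly_Mapping.keys n" "x \<notin> Poly_Mapping.keys m" by blast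
    then show ?thesis
      unfolding bit.meval_def by (intro prod_zero) (auto simp: v_def in_keys_iff)
  qed
  have "bit.meval v m = 1"
    unfolding bit.meval_def by (intro prod.neutral) (simp add: v_def)
  moreover have "ev p v = (\<Sum>n\<in>{m}. Poly_Mapping.lookup p n * bit.meval v n)"
    unfolding ev_def bit.peval_def
    by (rule sum.mono_neutral_right) (use m zero in auto)
  ultimately show False using assms(2) m by (simp add: in_keys_iff)
qed

lemma ev_inject:
  assumes "multilinear p" "multilinear q" "\<And>v. ev p v = ev q v" shows "p = q"
proof -
  have "p + q = p - q" by (rule poly_mapping_eqI) (simp add: lookup_add lookup_minus)
  moreover from this have "multilinear (p + q)" using multilinear_diff[OF assms(1,2)] by (simp only:)
  then have "p + q = 0" by (rule ev_eq_0D) (simp add: assms(3))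
  ultimately show ?thesis by simp
qed

lemma ev_substitute: "ev (const.peval \<sigma> p) v = ev p (\<lambda>x. ev (\<sigma> x) v)"
  using subset_UNIV[of "vars p"]
  by (induction p rule: poly2_induct) (simp_all add: const.peval_add const.peval_mult)

lemma vars_substitute:
  assumes "vars p \<subseteq> V" "\<And>v. v \<in> V \<Longrightarrow> vars (\<sigma> v) \<subseteq> W"
  shows "vars (const.peval \<sigma> p) \<subseteq> W"
  using assms(1)
proof (induction p rule: poly2_induct)
  case (add p q)
  then show ?case using vars_add[of "const.peval \<sigma> p" "const.peval \<sigma> q"] by (auto simp: const.peval_add)
next
  case (mult v p)
  then show ?case using vars_mult[of "\<sigma> v" "const.peval \<sigma> p"] assms(2)[of v] by (auto simp: const.peval_mult)
qed auto

lemma subst_eq: "subst y Q = const.peval (\<lambda>v. if v = y then Q else ind v)"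
  by (simp add: fun_eq_iff subst_def const.peval_def const.meval_def)

lemma ev_subst: "ev (subst y Q p) = ev p \<circ> assign y (ev Q)"
proof
  fix v
  have "(\<lambda>x. ev (if x = y then Q else ind x) v) = assign y (ev Q) v"
    by (auto simp: assign_def fun_eq_iff)
  then show "ev (subst y Q p) v = (ev p \<circ> assign y (ev Q)) v"
    by (simp add: subst_eq ev_substitute)
qed

text \<open>For the nontrivial direction, setting x to 0 does not change the function, so by
  uniqueness of multilinear representatives p equals a polynomial without x.\<close>

lemma indep_ev:
  assumes "multilinear p" shows "indep x (ev p) \<longleftrightarrow> x \<notin> vars p"
proof
  assume "x \<notin> vars p"
  then show "indep x (ev p)" using supported_indep[OF supported_ev[OF order_refl]] by metis
next
  assume i: "indep x (ev p)"
  have "ml (subst x 0 p) = p"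
    using assms i
    by (intro ev_inject) (auto simp: multilinear_ml ev_subst assign_def indep_update)
  moreover have "x \<notin> vars (ml (subst x 0 p))"
    using vars_ml[of "subst x 0 p"] vars_subst[of x 0 p] by auto
  ultimately show "x \<notin> vars p" by simp
qed

lemma vars_const [simp]: "vars (Poly_Mapping.single 0 c) = {}"
  by (simp add: vars_def)

lemma supported_singleton:
  fixes f :: "('v \<Rightarrow> bit) \<Rightarrow> bit"
  assumes "supported {w} f" shows "(\<exists>c. f = (\<lambda>_. c)) \<or> (\<exists>c. f = (\<lambda>v. v w + c))"
proof -
  have f: "f v = f (\<lambda>_. v w)" for v by (rule supportedD[OF assms]) simp
  show ?thesis
  proof (cases "f (\<lambda>_. 0) = f (\<lambda>_. 1)")
    case True
    have "f v = f (\<lambda>_. 0)" for v using f[of v] True by (cases "v w") simp_all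
    then have "f = (\<lambda>_. f (\<lambda>_. 0))" by (rule ext)
    then show ?thesis by blast
  next
    case False
    then have "f (\<lambda>_. 1) = 1 + f (\<lambda>_. 0)" by (cases "f (\<lambda>_. 0)"; cases "f (\<lambda>_. 1)") simp_all
    then have "f v = v w + f (\<lambda>_. 0)" for v using f[of v] by (cases "v w") simp_all
    then have "f = (\<lambda>v. v w + f (\<lambda>_. 0))" by (rule ext)
    then show ?thesis by blast
  qed
qed


section \<open>Transfer to path sums\<close>

text \<open>Lists of values retain the lengths of \<open>Out\<close> and \<open>In\<close>, so the
  signature can be recovered from the function.\<close>

definition obs :: "'v poly2 list \<Rightarrow> 'v poly2 list \<Rightarrow> ('v \<Rightarrow> bit) \<Rightarrow> bit list \<times> bit list" where
  "obs Out In v = (map (\<lambda>p. ev p v) Out, map (\<lambda>p. ev p v) In)"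

fun sem :: "'v path_sum \<Rightarrow> ('v, bit list \<times> bit list) state" where
  "sem (PathSum V s P Out In) = (V, s, ev P, obs Out In)"

fun zero_obs :: "'v path_sum \<Rightarrow> bit list \<times> bit list" where
  "zero_obs (PathSum V s P Out In) = (replicate (length Out) 0, replicate (length In) 0)"

lemma indep_obs:
  assumes "\<forall>p\<in>set Out \<union> set In. multilinear p"
  shows "indep x (obs Out In) \<longleftrightarrow> x \<notin> Vars (set Out \<union> set In)"
proof -
  have "indep x (obs Out In) \<longleftrightarrow> (\<forall>p\<in>set Out \<union> set In. indep x (ev p))"
    by (auto simp: indep_def obs_def)
  then show ?thesis using assms by (auto simp: indep_ev Vars_def)
qed

lemma PS_iff:
  "PathSum V s P Out In \<in> PS \<longleftrightarrow> finite V \<and> P \<in> BPoly V \<and> set Out \<subseteq> BPoly V \<and> set In \<subseteq> BPoly V"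
  by (auto simp: PS.simps)

lemma map_ev_inject:
  assumes "\<forall>p\<in>set ps \<union> set qs. multilinear p" "\<And>v. map (\<lambda>p. ev p v) ps = map (\<lambda>p. ev p v) qs"
  shows "ps = qs"
proof (rule nth_equalityI)
  show l: "length ps = length qs" using assms(2)[of "\<lambda>_. 0"] by (rule map_eq_imp_length_eq)
  fix i assume i: "i < length ps"
  have "ev (ps ! i) v = ev (qs ! i) v" for v
    using arg_cong[OF assms(2)[of v], of "\<lambda>xs. xs ! i"] i l by simp
  then show "ps ! i = qs ! i" using assms(1) i l by (intro ev_inject) auto
qed

lemma sem_inject:
  assumes "A \<in> PS" "B \<in> PS" "sem A = sem B" shows "A = B"
proof -
  obtain V s P Out In W t R Out' In' where A: "A = PathSum V s P Out In" "B = PathSum W t R Out' In'"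
    by (cases A, cases B)
  have e: "V = W" "s = t" "ev P = ev R" "obs Out In v = obs Out' In' v" for v
    using assms(3) by (auto simp: A)
  have "P = R" using e assms by (intro ev_inject) (auto simp: A PS_iff BPoly_iff)
  moreover have "Out = Out'" "In = In'" using e(4) assms
    by (auto simp: A PS_iff BPoly_iff obs_def subset_iff intro!: map_ev_inject)
  ultimately show ?thesis using e A by simp
qed

lemma vars_PS: "PathSum V s P Out In \<in> PS \<Longrightarrow> p \<in> set Out \<union> set In \<Longrightarrow> vars p \<subseteq> V"
  by (auto simp: PS_iff subset_iff BPoly_def)

lemma ev_red_subst:
  assumes "vars f \<subseteq> V" "x \<notin> vars f" "vars q \<subseteq> V" "x \<notin> vars q"
  shows "ev (red (V - {x}) (subst y q f)) = ev f \<circ> assign y (ev q)"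
proof -
  have "vars (subst y q f) \<subseteq> V - {x}" using assms vars_subst[of y q f] by blast
  then show ?thesis by (simp add: ev_red ev_subst)
qed

lemma good_sem:
  assumes "A \<in> PS" shows "good (sem A)"
proof (cases A)
  case (PathSum V s P Out In)
  then have v: "vars p \<subseteq> V" if "p \<in> set Out \<union> set In" for p
    using assms that vars_PS by blast
  have "supported V (obs Out In)"
    unfolding supported_def obs_def
    by (intro allI impI arg_cong2[where f = Pair] map_cong refl supportedD[OF supported_ev[OF v]]) auto
  then show ?thesis using assms PathSum by (simp add: PS_iff BPoly_iff supported_ev)
qed

section \<open>Correspondence of single steps\<close>

lemma step_sem:
  assumes "step A B" shows "fstep (zero_obs A) (sem A) (sem B) \<and> zero_obs B = zero_obs A"
proof -
  have ml: "multilinear P \<and> (\<forall>p\<in>set Out \<union> set In. multilinear p)"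
    if "PathSum V s P Out In \<in> PS" for V s P and Out In :: "'a poly2 list"
    using that by (auto simp: PS_iff BPoly_iff)
  from assms show ?thesis
    unfolding step_def sup_apply sup_bool_def
  proof (elim disjE)
    assume "step_elim A B"
    then show ?thesis
    proof cases
      case (1 V s P Out In x)
      note m = ml[OF 1(3)]
      have "indep x (ev P)" "indep x (obs Out In)" using 1 m by (auto simp: indep_ev indep_obs Vars_def)
      then show ?thesis using 1 by (auto intro: fstep.elim)
    qed
  next
    assume "step_z A B"
    then show ?thesis
    proof cases
      case (1 V s P Out In x R)
      note m = ml[OF 1(3)]
      have R: "multilinear R" "vars R \<subseteq> V" using 1 by (auto simp: BPoly_iff)
      have "ev P v = v x + ev R v" for v
        using 1(4) R by (subst 1(6), subst ev_red) (simp_all add: vars_subsetI)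
      moreover have "indep x (ev R)" "indep x (obs Out In)"
        using 1 m R by (auto simp: indep_ev indep_obs Vars_def)
      ultimately have "fstep (zero_obs A) (sem A) ({}, 0, \<lambda>_. 0, \<lambda>_. zero_obs A)"
        unfolding 1 using 1(4) by (simp add: indep_def add_ac fstep.zero[of x])
      moreover have "sem B = ({}, 0, \<lambda>_. 0, \<lambda>_. zero_obs A)"
        unfolding 1 by (simp add: fun_eq_iff obs_def)
      ultimately show ?thesis using 1 by simp
    qed
  next
    assume "step_hh A B"
    then show ?thesis
    proof cases
      case (1 V s P Out In x y Q R W \<sigma>)
      note m = ml[OF 1(3)]
      have R: "multilinear R" "vars R \<subseteq> V" "multilinear Q" "vars Q \<subseteq> V"
        using 1 by (auto simp: BPoly_iff)
      have P: "ev P v = v x * (v y + ev Q v) + ev R v" for v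
        using 1(4,5) R by (subst 1(9), subst ev_red) (simp_all add: vars_subsetI)
      have ind: "indep x (ev R)" "indep x (ev Q)" "indep y (ev Q)" "indep x (obs Out In)"
        using 1 m R by (auto simp: indep_ev indep_obs Vars_def)
      \<comment> \<open>For constant Q any element of V will do as u, and x provides one.\<close>
      obtain u where "vars Q \<subseteq> {u}" "u \<in> V"
        using 1(4,12) R(4) card_le_Suc0_iff_eq[of "vars Q"] finite_subset[OF R(4)] 1(3)
        by (cases "vars Q = {}") (auto simp: PS_iff)
      then have "affine1 V (ev Q)"
        using supported_singleton[OF supported_ev, of Q u] by (auto simp: affine1_def)
      then have "pivot V (ev P) (obs Out In) x y (ev Q)"
        using 1(4-6) ind by (simp add: pivot_def P indep_def distrib_left distrib_right add_ac)
      then have f: "fstep (zero_obs A) (sem A)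
          (V - {x}, s, ev P \<circ> assign y (ev Q), obs Out In \<circ> assign y (ev Q))"
        unfolding 1 sem.simps by (rule fstep.hh)
      have \<sigma>: "ev (\<sigma> f) = ev f \<circ> assign y (ev Q)" if "f \<in> {R} \<union> set Out \<union> set In" for f
      proof -
        have "vars f \<subseteq> V" using that R vars_PS[OF 1(3), of f] by blast
        moreover have "x \<notin> vars f" "x \<notin> vars Q" using 1(10) that by (auto simp: Vars_def)
        ultimately show ?thesis unfolding 1(13,14) using R(4) by (intro ev_red_subst)
      qed
      have "ev (\<sigma> R) = ev P \<circ> assign y (ev Q)"
        using \<sigma>[of R] ind by (auto simp: P fun_eq_iff assign_def indep_update)
      moreover have "obs (map \<sigma> Out) (map \<sigma> In) = obs Out In \<circ> assign y (ev Q)"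
        using \<sigma> by (auto simp: fun_eq_iff obs_def)
      ultimately show ?thesis using f 1 by simp
    qed
  qed
qed

lemma affine1_poly:
  assumes "affine1 V Q"
  shows "\<exists>q\<in>BPoly V. ev q = Q \<and> card (vars q) \<le> 1"
proof -
  have r: "ml p \<in> BPoly V \<and> card (vars (ml p)) \<le> 1" if "vars p \<subseteq> {u}" "vars p \<subseteq> V" for p u
    using that vars_ml[of p] card_mono[of "{u}" "vars (ml p)"] by (auto simp: BPoly_iff multilinear_ml)
  from assms consider c where "Q = (\<lambda>_. c)" | u c where "u \<in> V" "Q = (\<lambda>v. v u + c)"
    by (auto simp: affine1_def)
  then show ?thesis
  proof cases
    case (1 c)
    then show ?thesis using r[of "Poly_Mapping.single 0 c"]
      by (intro bexI[of _ "ml (Poly_Mapping.single 0 c)"]) (auto simp del: ml_single)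
  next
    case (2 u c)
    let ?p = "ind u + Poly_Mapping.single 0 c"
    have "vars ?p \<subseteq> {u}" using vars_add[of "ind u" "Poly_Mapping.single 0 c"] by simp
    then show ?thesis using 2 r[of ?p u]
      by (intro bexI[of _ "ml ?p"]) (auto simp del: ml_single)
  qed
qed

text \<open>Lifting in this direction brings the join found for states back to actual path sums. The
  polynomials Q and R demanded by the rules have to be rebuilt from functions.\<close>

lemma sem_step:
  assumes "A \<in> PS" "fstep (zero_obs A) (sem A) S"
  shows "\<exists>B. step A B \<and> sem B = S"
proof -
  obtain V s P Out In where A: "A = PathSum V s P Out In" by (cases A)
  have PS: "PathSum V s P Out In \<in> PS" using assms A by simp
  have m: "finite V" "multilinear P" "vars P \<subseteq> V" "\<forall>p\<in>set Out \<union> set In. multilinear p"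
    using PS by (auto simp: PS_iff BPoly_iff)
  from assms(2)[unfolded A sem.simps] show ?thesis
  proof cases
    case (elim x)
    then have "x \<notin> Vars ({P} \<union> set Out \<union> set In)"
      using m by (auto simp: indep_ev indep_obs Vars_def)
    then show ?thesis
      using step_elim.intros[OF PS elim(2)] elim(1) A by (auto simp: step_def)
  next
    case (zero x)
    define R where "R = ml (P + ind x)"
    have v: "vars (P + ind x) \<subseteq> V" using m(3) zero(2) by (simp add: vars_subsetI)
    then have R: "R \<in> BPoly V" by (simp add: R_def BPoly_iff multilinear_ml vars_subsetI)
    have "vars (ind x + R) \<subseteq> V" using R zero(2) by (simp add: BPoly_iff vars_subsetI)
    then have "P = red V (ind x + R)"
      using m by (intro ev_inject) (auto simp: red_eq_ml multilinear_ml R_def add_ac)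
    moreover have "indep x (ev R)" using zero by (auto simp: R_def indep_def add_ac)
    then have "x \<notin> Vars ({R} \<union> set Out \<union> set In)"
      using m zero R by (auto simp: indep_ev indep_obs Vars_def BPoly_iff)
    ultimately have "step_z A (PathSum {} 0 0 (replicate (length Out) 0) (replicate (length In) 0))"
      unfolding A by (intro step_z.intros[OF PS zero(2) R])
    moreover have "sem (PathSum {} 0 0 (replicate (length Out) 0) (replicate (length In) 0)) = S"
      unfolding zero by (simp add: fun_eq_iff obs_def A)
    ultimately show ?thesis by (auto simp: step_def)
  next
    case (hh x y Q)
    note d = pivotD[OF hh(2)]
    obtain q where q: "q \<in> BPoly V" "ev q = Q" "card (vars q) \<le> 1" using affine1_poly d(4) by blast
    let ?L = "ind x * (ind y + q)"
    have L: "vars ?L \<subseteq> V"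
      using d(1,2) q(1) by (simp add: BPoly_iff vars_subsetI)
    \<comment> \<open>Addition is subtraction in characteristic 2, so this solves P = x(y + q) + R.
      Both summands have derivative y + Q along x, so R is free of x.\<close>
    define R where "R = ml (P + ?L)"
    have R: "R \<in> BPoly V" using L m(3) by (simp add: R_def BPoly_iff multilinear_ml vars_subsetI)
    have evR: "ev R v = ev P v + v x * (v y + Q v)" for v by (simp add: R_def q)
    have "vars (?L + R) \<subseteq> V" using L R by (simp add: BPoly_iff vars_subsetI)
    then have P: "P = red V (?L + R)"
      using m by (intro ev_inject) (auto simp: red_eq_ml multilinear_ml evR q add.left_commute)
    have "indep x (ev R)"
      using d(6) d(7) by (simp add: indep_def evR d(8) distrib_left distrib_right add_ac)
    then have x: "x \<notin> Vars ({q, R} \<union> set Out \<union> set In)"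
      using m d R q by (auto simp: indep_ev[symmetric] Vars_def BPoly_iff indep_obs)
    have y: "y \<notin> vars q" using q d(5) by (simp add: indep_ev[symmetric] BPoly_iff)
    define \<sigma> where "\<sigma> = (\<lambda>f. red (V - {x}) (subst y q f))"
    define B where "B = PathSum (V - {x}) s (\<sigma> R) (map \<sigma> Out) (map \<sigma> In)"
    have "step A B"
      unfolding step_def A B_def
      using step_hh.intros[OF PS d(1,2,6) q(1) R P x y q(3) refl \<sigma>_def] by simp
    have \<sigma>: "ev (\<sigma> f) = ev f \<circ> assign y Q" if "f \<in> {R} \<union> set Out \<union> set In" for f
    proof -
      have "vars f \<subseteq> V" using that R vars_PS[OF PS, of f] unfolding BPoly_iff by blast
      moreover have "x \<notin> vars f" "x \<notin> vars q" using x that by (auto simp: Vars_def)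
      ultimately show ?thesis
        unfolding \<sigma>_def q(2)[symmetric] using q(1) by (intro ev_red_subst) (simp_all add: BPoly_iff)
    qed
    have "ev (\<sigma> R) = ev P \<circ> assign y Q"
      using \<sigma>[of R] d(5) by (auto simp: evR fun_eq_iff assign_def indep_update)
    moreover have "obs (map \<sigma> Out) (map \<sigma> In) = obs Out In \<circ> assign y Q"
      using \<sigma> by (auto simp: fun_eq_iff obs_def)
    ultimately show ?thesis using \<open>step A B\<close> hh(1) by (auto simp: B_def)
  qed
qed

section \<open>Simple transformations and affine renamings\<close>

lemma ind_add_const:
  fixes w :: 'v and c :: bit
  defines "p \<equiv> ind w + Poly_Mapping.single 0 c"
  shows "deg p = 1" "vars p = {w}" "multilinear p"
proof -
  have ne: "Poly_Mapping.single w (Suc 0) \<noteq> 0"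
    by (metis lookup_single_eq lookup_zero nat.distinct(1))
  have keys: "Poly_Mapping.keys p = insert (Poly_Mapping.single w 1) (if c = 0 then {} else {0})"
    using ne by (auto simp: p_def in_keys_iff lookup_add lookup_one ind_def lookup_single when_def split: if_splits)
  show "deg p = 1" by (simp add: deg_def keys mdeg_def)
  show "vars p = {w}" by (auto simp: vars_def keys)
  show "multilinear p" by (auto simp: multilinear_def keys lookup_single when_def)
qed

lemma multilinear_const: "multilinear (Poly_Mapping.single 0 c)"
  by (auto simp: multilinear_def split: if_splits)

lemma deg_const: "deg (Poly_Mapping.single 0 c) = 0"
  by (simp add: deg_def mdeg_def)

text \<open>Degree 1 forces q to be multilinear, so its function determines it. That function
  depends on one variable only and is not constant, since constants have degree 0.\<close>

lemma linear_cases: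
  assumes "deg q = 1" "card (vars q) \<le> 1" "vars q \<subseteq> W" "finite W"
  shows "\<exists>w\<in>W. \<exists>c. q = ind w + Poly_Mapping.single 0 c"
proof -
  have ml: "multilinear q"
    unfolding multilinear_def
  proof (intro ballI allI)
    fix m v assume m: "m \<in> Poly_Mapping.keys q"
    have "mdeg m \<le> deg q" unfolding deg_def using m by (intro Max_ge) auto
    moreover have "Poly_Mapping.lookup m v \<le> mdeg m"
    proof (cases "v \<in> Poly_Mapping.keys m")
      case True
      then show ?thesis unfolding mdeg_def by (intro member_le_sum) auto
    qed (simp add: in_keys_iff)
    ultimately show "Poly_Mapping.lookup m v \<le> 1" using assms(1) by simp
  qed
  have no: "ev q \<noteq> (\<lambda>_. c)" for c
  proof
    assume "ev q = (\<lambda>_. c)"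
    then have "q = Poly_Mapping.single 0 c" using ml by (intro ev_inject) (simp_all add: multilinear_const)
    then show False using assms(1) by (simp add: deg_const)
  qed
  have "vars q \<noteq> {}"
  proof
    assume "vars q = {}"
    then have "ev q = (\<lambda>_. ev q (\<lambda>_. 0))"
      using supportedD[OF supported_ev[of q "{}"]] by (intro ext) simp
    then show False using no by blast
  qed
  moreover have "finite (vars q)" using assms finite_subset by metis
  ultimately obtain w where w: "vars q = {w}"
    using assms(2) by (metis card_1_singletonE card_0_eq le_antisym less_one not_le)
  then obtain c where c: "ev q = (\<lambda>v. v w + c)"
    using supported_singleton[OF supported_ev[of q "{w}"]] no by auto
  have "q = ind w + Poly_Mapping.single 0 c"
    using ml c ind_add_const(3) by (intro ev_inject) simp_all
  then show ?thesis using w assms(3) by blast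
qed

lemma simple_transformation_sem:
  assumes "simple_transformation V W \<phi>"
  shows "\<exists>g c. bij_betw g V W \<and> (\<forall>p. vars p \<subseteq> V \<longrightarrow> vars (\<phi> p) \<subseteq> W \<and> ev (\<phi> p) = ev p \<circ> affine_map g c)"
proof -
  have fin: "finite V" "finite W" "card V = card W" and iso: "\<phi> \<in> ring_iso (F2 V) (F2 W)"
    and lin: "\<And>v. v \<in> V \<Longrightarrow> deg (\<phi> (ind v)) = 1 \<and> card (vars (\<phi> (ind v))) \<le> 1"
    using assms by (auto simp: simple_transformation_def)
  have closed: "vars (\<phi> p) \<subseteq> W" if "vars p \<subseteq> V" for p
    using ring_iso_memE(1)[OF iso, of p] that by simp
  have mult: "\<phi> (p * q) = \<phi> p * \<phi> q" and add: "\<phi> (p + q) = \<phi> p + \<phi> q"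
    if "vars p \<subseteq> V" "vars q \<subseteq> V" for p q
    using ring_iso_memE(2,3)[OF iso, of p q] that by simp_all
  have one: "\<phi> 1 = 1" using ring_iso_memE(4)[OF iso] by simp
  have zero: "\<phi> 0 = 0" using add[of 0 0] by simp
  have inj: "p = q" if "\<phi> p = \<phi> q" "vars p \<subseteq> V" "vars q \<subseteq> V" for p q
    using ring_iso_memE(5)[OF iso] that by (auto simp: bij_betw_def inj_on_def)
  have const: "\<phi> (Poly_Mapping.single 0 e) = Poly_Mapping.single 0 e" for e
    by (cases e) (simp_all add: zero one)
  have "\<forall>v\<in>V. \<exists>w c. w \<in> W \<and> \<phi> (ind v) = ind w + Poly_Mapping.single 0 c"
    using linear_cases lin closed fin by (metis empty_subsetI insert_subset vars_ind)
  then obtain g c where g: "\<And>v. v \<in> V \<Longrightarrow> g v \<in> W"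
    and c: "\<And>v. v \<in> V \<Longrightarrow> \<phi> (ind v) = ind (g v) + Poly_Mapping.single 0 (c v)"
    by metis
  have "inj_on g V"
  proof (rule inj_onI, rule ccontr)
    fix u v assume uv: "u \<in> V" "v \<in> V" "g u = g v" "u \<noteq> v"
    \<comment> \<open>If g u = g v, then \<phi> maps u + c u + c v and v to the same polynomial,
      against its injectivity.\<close>
    let ?e = "Poly_Mapping.single 0 (c u + c v)"
    have "\<phi> (ind u + ?e) = \<phi> (ind v)"
      using uv by (simp add: add const c single_add[symmetric] add_ac)
    then have "ind u + ?e = ind v"
      by (rule inj) (use uv in \<open>simp_all add: vars_subsetI\<close>)
    then have "ev (ind u + ?e) w = ev (ind v) w" for w by simp
    \<comment> \<open>The zero point makes the constant 0, while the point whose only nonzero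
      coordinate is u makes it 1.\<close>
    from this[of "\<lambda>_. 0"] this[of "(\<lambda>_. 0)(u := 1)"] show False using uv(4) by simp
  qed
  moreover from this have "g ` V = W" using g fin by (intro card_subset_eq) (auto simp: card_image)
  moreover have "ev (\<phi> p) v = ev p (affine_map g c v)" if "vars p \<subseteq> V" for p v
    using that
    by (induction p rule: poly2_induct) (simp_all add: zero one add mult c affine_map_def)
  ultimately show ?thesis using closed by (auto simp: bij_betw_def intro!: exI[of _ g] exI[of _ c])
qed

text \<open>The substitution by g v + c v is invertible already on the full polynomial rings, before
  passing to the quotients; \<psi> is its explicit inverse.\<close>

lemma simple_transformation_exists:
  assumes "finite V" "bij_betw g V W"
  shows "\<exists>\<phi>. simple_transformation V W \<phi> \<and>
    (\<forall>p. vars p \<subseteq> V \<longrightarrow> vars (\<phi> p) \<subseteq> W \<and> ev (\<phi> p) = ev p \<circ> affine_map g c)"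
proof -
  define h where "h = inv_into V g"
  have h: "\<And>w. w \<in> W \<Longrightarrow> h w \<in> V \<and> g (h w) = w" "\<And>v. v \<in> V \<Longrightarrow> g v \<in> W \<and> h (g v) = v"
    using assms(2) by (auto simp: h_def bij_betw_def inv_into_into f_inv_into_f)
  define \<sigma> where "\<sigma> v = ind (g v) + Poly_Mapping.single 0 (c v)" for v
  \<comment> \<open>The shift is that of the source variable h w, so that it cancels the one
    introduced by \<sigma>.\<close>
  define \<tau> where "\<tau> w = ind (h w) + Poly_Mapping.single 0 (c (h w))" for w
  define \<phi> where "\<phi> = const.peval \<sigma>"
  define \<psi> where "\<psi> = const.peval \<tau>"
  have \<phi>: "vars (\<phi> p) \<subseteq> W" if "vars p \<subseteq> V" for p
    unfolding \<phi>_def using that h by (intro vars_substitute) (auto simp: \<sigma>_def ind_add_const(2))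
  have \<psi>: "vars (\<psi> p) \<subseteq> V" if "vars p \<subseteq> W" for p
    unfolding \<psi>_def using that h by (intro vars_substitute) (auto simp: \<tau>_def ind_add_const(2))
  have dbl: "ind v + Poly_Mapping.single 0 e + Poly_Mapping.single 0 e = ind v" for v :: 'a and e
    by (simp add: add.assoc single_add[symmetric])
  have "\<psi> (\<phi> p) = p" if "vars p \<subseteq> V" for p
    using that
  proof (induction p rule: poly2_induct)
    case (mult v p)
    then show ?case using h(2)[of v]
      by (simp add: \<phi>_def \<psi>_def const.peval_mult const.peval_add \<sigma>_def \<tau>_def dbl)
  qed (simp_all add: \<phi>_def \<psi>_def const.peval_add)
  moreover have "\<phi> (\<psi> p) = p" if "vars p \<subseteq> W" for p
    using that
  proof (induction p rule: poly2_induct)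
    case (mult v p)
    then show ?case using h(1)[of v]
      by (simp add: \<phi>_def \<psi>_def const.peval_mult const.peval_add \<sigma>_def \<tau>_def dbl)
  qed (simp_all add: \<phi>_def \<psi>_def const.peval_add)
  ultimately have "bij_betw \<phi> (carrier (F2 V)) (carrier (F2 W))"
    using \<phi> \<psi> by (intro bij_betw_byWitness[of _ \<psi>]) (simp_all add: image_subset_iff)
  then have "\<phi> \<in> ring_iso (F2 V) (F2 W)"
    using \<phi> by (auto simp: ring_iso_def \<phi>_def const.peval_mult const.peval_add intro!: ring_hom_memI)
  then have "simple_transformation V W \<phi>"
    using assms bij_betw_same_card[OF assms(2)] bij_betw_finite[OF assms(2)]
    by (auto simp: simple_transformation_def \<phi>_def \<sigma>_def ind_add_const)
  moreover have "ev (\<phi> p) = ev p \<circ> affine_map g c" for p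
    by (simp add: fun_eq_iff \<phi>_def ev_substitute \<sigma>_def affine_map_def)
  ultimately show ?thesis using \<phi> by blast
qed

lemma sem_transform:
  assumes "A \<in> PS" "index_set A = V"
    and \<phi>: "\<And>p. vars p \<subseteq> V \<Longrightarrow> vars (\<phi> p) \<subseteq> W \<and> ev (\<phi> p) = ev p \<circ> affine_map g c"
    and "bij_betw g V W"
  shows "feq (sem A) (sem (transform W \<phi> A))" "zero_obs (transform W \<phi> A) = zero_obs A"
proof -
  obtain s P Out In where A: "A = PathSum V s P Out In" using assms(2) by (cases A) auto
  have *: "ev (red W (\<phi> p)) = ev p \<circ> affine_map g c" if "p \<in> {P} \<union> set Out \<union> set In" for p
  proof -
    have "vars p \<subseteq> V" using that vars_PS assms(1) by (auto simp: A PS_iff BPoly_iff subset_iff)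
    then show ?thesis using \<phi>[of p] by (simp add: ev_red)
  qed
  have "feq (V, s, ev P, obs Out In)
      (W, s, ev (red W (\<phi> P)), obs (map (red W \<circ> \<phi>) Out) (map (red W \<circ> \<phi>) In))"
    using * by (intro feq.intros[OF assms(4), where c = c]) (simp_all add: obs_def fun_eq_iff)
  then show "feq (sem A) (sem (transform W \<phi> A))" by (simp add: A)
  show "zero_obs (transform W \<phi> A) = zero_obs A" by (simp add: A)
qed

lemma simple_equiv_sem:
  assumes "A \<in> PS" "A \<sim>\<^sub>s B" shows "feq (sem A) (sem B)" "zero_obs B = zero_obs A"
proof -
  obtain W \<phi> where \<phi>: "simple_transformation (index_set A) W \<phi>" "B = transform W \<phi> A"
    using assms(2) by (auto simp: simple_equiv_def)
  from simple_transformation_sem[OF \<phi>(1)] obtain g c where "bij_betw g (index_set A) W"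
    "\<And>p. vars p \<subseteq> index_set A \<Longrightarrow> vars (\<phi> p) \<subseteq> W \<and> ev (\<phi> p) = ev p \<circ> affine_map g c" by blast
  then show "feq (sem A) (sem B)" "zero_obs B = zero_obs A"
    using sem_transform[OF assms(1) refl, of \<phi> W g c] \<phi>(2) by auto
qed

text \<open>The renaming of states is realized by some \<phi>; that
  \<open>transform W \<phi> A\<close> is literally B, and not merely a path sum with equal values,
  is the injectivity of \<open>sem\<close> on path sums.\<close>

lemma sem_simple_equiv:
  assumes "A \<in> PS" "B \<in> PS" "feq (sem A) (sem B)" shows "A \<sim>\<^sub>s B"
proof -
  obtain V s P Out In where A: "A = PathSum V s P Out In" by (cases A)
  obtain W t R Out' In' where B: "B = PathSum W t R Out' In'" by (cases B)
  have fin: "finite V" using assms(1) by (simp add: A PS_iff)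
  from assms(3)[unfolded A B sem.simps] show ?thesis
  proof cases
    case (1 g c)
    from simple_transformation_exists[OF fin 1(2)] obtain \<phi> where \<phi>: "simple_transformation V W \<phi>"
      "\<And>p. vars p \<subseteq> V \<Longrightarrow> vars (\<phi> p) \<subseteq> W \<and> ev (\<phi> p) = ev p \<circ> affine_map g c" by blast
    have eq: "A \<sim>\<^sub>s transform W \<phi> A" using \<phi>(1) by (auto simp: simple_equiv_def A)
    have p: "vars p \<subseteq> V" if "p \<in> {P} \<union> set Out \<union> set In" for p
      using that vars_PS assms(1) by (auto simp: A PS_iff BPoly_iff subset_iff)
    have *: "ev (red W (\<phi> p)) v = ev p (affine_map g c v)" if "p \<in> {P} \<union> set Out \<union> set In" for p v
      using \<phi>(2)[OF p[OF that]] by (simp add: ev_red)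
    have "obs (map (red W \<circ> \<phi>) Out) (map (red W \<circ> \<phi>) In) = obs Out' In'"
      unfolding 1(4) using * by (simp add: obs_def fun_eq_iff)
    moreover have "ev (red W (\<phi> P)) = ev R" unfolding 1(3) using * by (simp add: fun_eq_iff)
    ultimately have "sem (transform W \<phi> A) = sem B" using 1 by (simp add: A B)
    then have "transform W \<phi> A = B"
      using simple_equiv_PS[OF assms(1) eq] assms(2) by (rule sem_inject[rotated 2])
    then show ?thesis using eq by simp
  qed
qed

section \<open>Transfer of reduction sequences and conclusion\<close>

lemma steps_sem:
  assumes "step\<^sup>*\<^sup>* A B"
  shows "(fstep (zero_obs A))\<^sup>*\<^sup>* (sem A) (sem B) \<and> zero_obs B = zero_obs A \<and> (A \<in> PS \<longrightarrow> B \<in> PS)"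
  using assms
proof (induction rule: rtranclp_induct)
  case (step B C)
  then show ?case using step_sem[OF step.hyps(2)] step_PS[OF step.hyps(2)] by auto
qed simp

lemma sem_steps:
  assumes "(fstep (zero_obs A))\<^sup>*\<^sup>* (sem A) S" "A \<in> PS"
  shows "\<exists>B. step\<^sup>*\<^sup>* A B \<and> sem B = S"
  using assms(1)
proof (induction rule: rtranclp_induct)
  case (step S T)
  then obtain B where B: "step\<^sup>*\<^sup>* A B" "sem B = S" by blast
  then have "B \<in> PS" "zero_obs B = zero_obs A" using steps_sem assms(2) by blast+
  then obtain C where C: "step B C" "sem C = T" using sem_step step.hyps(2) B(2) by metis
  show ?case using rtranclp.rtrancl_into_rtrancl[OF B(1) C(1)] C(2) by blast
qed blast

theorem theorem19:
  fixes A B C D :: "'v path_sum"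
  assumes "A \<in> PS" "B \<in> PS" "C \<in> PS" "D \<in> PS"
    and "A \<sim>\<^sub>s B" and "step\<^sup>*\<^sup>* A C" and "step\<^sup>*\<^sup>* B D"
  shows "\<exists>C'\<in>PS. \<exists>D'\<in>PS. step\<^sup>*\<^sup>* C C' \<and> step\<^sup>*\<^sup>* D D' \<and> C' \<sim>\<^sub>s D'"
proof -
  note AB = simple_equiv_sem[OF assms(1,5)]
  have z: "zero_obs C = zero_obs A" "zero_obs D = zero_obs A"
    using steps_sem assms(6,7) AB(2) by metis+
  have "joinable (zero_obs A) (sem C) (sem D)"
    using confluence_modulo[OF AB(1)] steps_sem[OF assms(6)] steps_sem[OF assms(7)] AB(2)
      good_sem[OF assms(1)] by metis
  then obtain S T where ST: "(fstep (zero_obs C))\<^sup>*\<^sup>* (sem C) S" "(fstep (zero_obs D))\<^sup>*\<^sup>* (sem D) T" "feq S T"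
    unfolding joinable_def z by blast
  obtain C' where C': "step\<^sup>*\<^sup>* C C'" "sem C' = S" using sem_steps[OF ST(1) assms(3)] by blast
  obtain D' where D': "step\<^sup>*\<^sup>* D D'" "sem D' = T" using sem_steps[OF ST(2) assms(4)] by blast
  have "C' \<in> PS" "D' \<in> PS" using steps_sem C'(1) D'(1) assms(3,4) by blast+
  then show ?thesis using sem_simple_equiv ST(3) C' D' by blast
qed

end
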